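(* Let $A\subseteq C\subseteq B$ be extensions of rings with $A\subseteq C$ subintegral. Then the sequence of natural maps $$1\rightarrow M\mathcal{I}(A,C)\rightarrow M\mathcal{I}(A,B)\rightarrow M\mathcal{I}(C,B)\rightarrow 1$$ is exact.
   Context: All rings are commutative with $1$ and ring homomorphisms are unitary; $X$ is an indeterminate. For a ring extension $A\subseteq B$, an $A$-submodule $I$ of $B$ is invertible if there is an $A$-submodule $J$ of $B$ with $IJ=A$; $\mathcal{I}(A,B)$ is the group, under multiplication, of invertible $A$-submodules of $B$. $M\mathcal{I}(A,B)$ denotes the cokernel of the natural map $\mathcal{I}(A,B)\to\mathcal{I}(A[X,X^{-1}],B[X,X^{-1}])$, $I\mapsto I A[X,X^{-1}]$. For $A\subseteq C\subseteq B$, the map $M\mathcal{I}(A,C)\to M\mathcal{I}(A,B)$ is induced by the inclusion $\mathcal{I}(A[X,X^{-1}],C[X,X^{-1}])\subseteq\mathcal{I}(A[X,X^{-1}],B[X,X^{-1}])$, and the map $M\mathcal{I}(A,B)\to M\mathcal{I}(C,B)$ is induced by $J\mapsto J\,C[X,X^{-1}]$. An extension $A\subseteq C$ is elementary subintegral if $C=A[c]$ for some $c\in C$ with $c^2,c^3\in A$. An extension $A\subseteq C$ is subintegral if for each $c\in C$ there is a finite sequence of ring extensions $A=C_0\subseteq C_1\subseteq\cdots\subseteq C_r\subseteq C$ with $c\in C_r$ and each $C_{i-1}\subseteq C_i$ elementary subintegral ($1\le i\le r$). *)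

theory Defs
  imports "HOL-Algebra.Algebra"
begin

text \<open>
  A ring extension is a subring \<open>A\<close> of a ring \<open>B\<close> given by its carrier set; the ring \<open>A\<close> itself
  is the record \<open>B\<lparr>carrier := A\<rparr>\<close>. Since the rings are those of the locale \<open>cring\<close>,
  the zero ring is allowed.
\<close>

text \<open>\<open>R[X, X\<^sup>-\<^sup>1]\<close>: a Laurent polynomial is the family of its coefficients, indexed by the integers.\<close>

definition laurent :: "('a, 'b) ring_scheme \<Rightarrow> (int \<Rightarrow> 'a) ring" where
  "laurent R =
     \<lparr> carrier = {f. (\<forall>n. f n \<in> carrier R) \<and> finite {n. f n \<noteq> \<zero>\<^bsub>R\<^esub>}},
       monoid.mult = (\<lambda>f g n. \<Oplus>\<^bsub>R\<^esub>i\<in>{i. f i \<noteq> \<zero>\<^bsub>R\<^esub>}. f i \<otimes>\<^bsub>R\<^esub> g (n - i)),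
       one = (\<lambda>n. if n = 0 then \<one>\<^bsub>R\<^esub> else \<zero>\<^bsub>R\<^esub>),
       ring.zero = (\<lambda>n. \<zero>\<^bsub>R\<^esub>),
       add = (\<lambda>f g n. f n \<oplus>\<^bsub>R\<^esub> g n) \<rparr>"

definition laurent_const :: "('a, 'b) ring_scheme \<Rightarrow> 'a \<Rightarrow> int \<Rightarrow> 'a" where
  "laurent_const R b = (\<lambda>n. if n = 0 then b else \<zero>\<^bsub>R\<^esub>)"

text \<open>The carrier of \<open>A[X, X\<^sup>-\<^sup>1]\<close>, as a subset of \<open>B[X, X\<^sup>-\<^sup>1]\<close>.\<close>

abbreviation laurent_sub :: "('a, 'b) ring_scheme \<Rightarrow> 'a set \<Rightarrow> (int \<Rightarrow> 'a) set" where
  "laurent_sub B A \<equiv> carrier (laurent (B\<lparr>carrier := A\<rparr>))"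

text \<open>\<open>B\<close> as a module over its subrings: scalar multiplication is the multiplication of \<open>B\<close>.\<close>

definition ring_as_module :: "('a, 'b) ring_scheme \<Rightarrow> ('a, 'a) module" where
  "ring_as_module B =
     \<lparr> carrier = carrier B, monoid.mult = monoid.mult B, one = one B, ring.zero = ring.zero B, add = add B,
       smult = monoid.mult B \<rparr>"

abbreviation submodule_over :: "'a set \<Rightarrow> ('a, 'b) ring_scheme \<Rightarrow> 'a set \<Rightarrow> bool" where
  "submodule_over A B I \<equiv> submodule I (B\<lparr>carrier := A\<rparr>) (ring_as_module B)"

text \<open>
  The product \<open>I J\<close> of submodules is \<open>ideal_prod B I J\<close>, the set of nonempty finite sums of
  products \<open>i \<otimes> j\<close>; its definition makes sense for arbitrary subsets of \<open>B\<close>.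
\<close>

definition invertible_submodule :: "'a set \<Rightarrow> ('a, 'b) ring_scheme \<Rightarrow> 'a set \<Rightarrow> bool" where
  "invertible_submodule A B I \<longleftrightarrow>
     submodule_over A B I \<and> (\<exists>J. submodule_over A B J \<and> ideal_prod B I J = A)"

definition inv_group :: "'a set \<Rightarrow> ('a, 'b) ring_scheme \<Rightarrow> 'a set monoid" where
  "inv_group A B =
     \<lparr> carrier = {I. invertible_submodule A B I}, monoid.mult = ideal_prod B, one = A \<rparr>"

definition laurent_inv_group :: "'a set \<Rightarrow> ('a, 'b) ring_scheme \<Rightarrow> (int \<Rightarrow> 'a) set monoid" where
  "laurent_inv_group A B = inv_group (laurent_sub B A) (laurent B)"

text \<open>The map \<open>I \<mapsto> I A[X, X\<^sup>-\<^sup>1]\<close>; elements of \<open>I\<close> become constant Laurent polynomials.\<close>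

definition laurent_extend :: "'a set \<Rightarrow> ('a, 'b) ring_scheme \<Rightarrow> 'a set \<Rightarrow> (int \<Rightarrow> 'a) set" where
  "laurent_extend A B I = ideal_prod (laurent B) (laurent_const B ` I) (laurent_sub B A)"

definition laurent_image :: "'a set \<Rightarrow> ('a, 'b) ring_scheme \<Rightarrow> (int \<Rightarrow> 'a) set set" where
  "laurent_image A B = laurent_extend A B ` carrier (inv_group A B)"

definition MI :: "'a set \<Rightarrow> ('a, 'b) ring_scheme \<Rightarrow> (int \<Rightarrow> 'a) set set monoid" where
  "MI A B = laurent_inv_group A B Mod laurent_image A B"

text \<open>
  The map \<open>G Mod N \<rightarrow> H Mod K\<close> induced by \<open>h\<close>. When \<open>h\<close> is a homomorphism sending \<open>N\<close> into \<open>K\<close>,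
  all elements of a coset \<open>S\<close> give the same coset of \<open>K\<close>, which \<open>the_elem\<close> picks out.
\<close>

definition induced_map ::
    "('c, 'd) monoid_scheme \<Rightarrow> 'c set \<Rightarrow> ('a \<Rightarrow> 'c) \<Rightarrow> 'a set \<Rightarrow> 'c set" where
  "induced_map H K h S = the_elem ((\<lambda>x. K #>\<^bsub>H\<^esub> h x) ` S)"

text \<open>\<open>MI(A, C) \<rightarrow> MI(A, B)\<close>, where the ring \<open>C\<close> is \<open>B\<lparr>carrier := C\<rparr>\<close>.\<close>

definition MI_incl ::
    "'a set \<Rightarrow> ('a, 'b) ring_scheme \<Rightarrow> (int \<Rightarrow> 'a) set set \<Rightarrow> (int \<Rightarrow> 'a) set set" where
  "MI_incl A B = induced_map (laurent_inv_group A B) (laurent_image A B) (\<lambda>J. J)"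

text \<open>\<open>MI(A, B) \<rightarrow> MI(C, B)\<close>\<close>

definition MI_ext ::
    "'a set \<Rightarrow> ('a, 'b) ring_scheme \<Rightarrow> (int \<Rightarrow> 'a) set set \<Rightarrow> (int \<Rightarrow> 'a) set set" where
  "MI_ext C B =
     induced_map (laurent_inv_group C B) (laurent_image C B)
       (\<lambda>J. ideal_prod (laurent B) J (laurent_sub B C))"

text \<open>In the next two definitions \<open>B\<close> is only an ambient ring containing \<open>A \<subseteq> C\<close>.\<close>

definition elementary_subintegral :: "('a, 'b) ring_scheme \<Rightarrow> 'a set \<Rightarrow> 'a set \<Rightarrow> bool" where
  "elementary_subintegral B A C \<longleftrightarrow>
     subring A B \<and> subring C B \<and> A \<subseteq> C \<and>
     (\<exists>c\<in>C. c [^]\<^bsub>B\<^esub> (2::nat) \<in> A \<and> c [^]\<^bsub>B\<^esub> (3::nat) \<in> A \<and> C = generate_ring B (insert c A))"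

definition subintegral :: "('a, 'b) ring_scheme \<Rightarrow> 'a set \<Rightarrow> 'a set \<Rightarrow> bool" where
  "subintegral B A C \<longleftrightarrow>
     subring A B \<and> subring C B \<and> A \<subseteq> C \<and>
     (\<forall>c\<in>C. \<exists>(r::nat) D. D 0 = A \<and> D r \<subseteq> C \<and> c \<in> D r \<and>
        (\<forall>i\<in>{1..r}. elementary_subintegral B (D (i - 1)) (D i)))"

end

theory Submission
  imports Defs
begin

text \<open>
  The cokernels fit into a comparison of \<open>1 \<rightarrow> I(A,C) \<rightarrow> I(A,B) \<rightarrow> I(C,B) \<rightarrow> 1\<close> with the same sequence
  for Laurent polynomials. The module \<open>I A[X, X\<^sup>-\<^sup>1]\<close> consists of the Laurent polynomials with
  coefficients in \<open>I\<close>, so the comparison maps are injective, and it suffices that both sequences are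
  exact. Exactness at the first two places is formal: \<open>I C = C\<close> forces \<open>I\<close> and its inverse into \<open>C\<close>.

  For surjectivity of \<open>I(A,B) \<rightarrow> I(C,B)\<close>, a relation \<open>1 = \<Sum>\<^sub>i k\<^sub>i j\<^sub>i\<close> in \<open>K J = C\<close> involves only
  finitely many elements of \<open>C\<close>, hence lives over a subring reached from \<open>A\<close> by finitely many
  elementary subintegral steps; this remains true for Laurent polynomials. A single step has the
  shape \<open>C = A + N\<close> for an ideal \<open>N\<close> of \<open>C\<close> with \<open>N N \<subseteq> A\<close>. There \<open>C \<rightarrow> C / A\<close> is a derivation,
  which induces connections \<open>T\<close> on \<open>K\<close> and \<open>S\<close> on \<open>J\<close> with \<open>d(x y) = T(x) y + x S(y)\<close>, and the
  horizontal elements of \<open>K\<close> and \<open>J\<close> are mutually inverse \<open>A\<close>-modules.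
\<close>

section \<open>Invertible submodules\<close>

text \<open>The comparison is a snake argument in which surjectivity is needed in both rows. The
  Laurent row gives the right end of the cokernel sequence; the row of constants gives exactness in
  the middle, where an extended module over \<open>C\<close> must be lifted to an extended module
  over \<open>A\<close> before it can be divided out. In a single step
  \<open>C / A = N / (A \<inter> N)\<close>, and modulo the ideal \<open>A \<inter> N\<close> of
  \<open>C\<close> the ideal \<open>N\<close> has square zero; so the derivation has values in a
  \<open>C\<close>-module. A relation 1 = sum of k_i j_i is a dual basis of the projective module
  \<open>K\<close>: it makes \<open>K\<close> a direct summand of a free module, and T(x) = sum of
  d(x j_i) k_i is the connection inherited from there. The obstacle is that \<open>A + N\<close>
  need not be a direct sum. Hence \<open>T\<close> is meaningful only modulo
  \<open>A \<inter> N\<close> and after pairing with \<open>J\<close>, and the horizontal modules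
  first yield 1 only up to an error n in \<open>A \<inter> N\<close>. The error disappears because n
  K and n J consist of horizontal elements. What is carried over to Laurent polynomials is not
  subintegrality itself but its consequence that every finite subset lies in a finite tower.\<close>

context cring begin

text \<open>Closure under negation comes from the scalar -1, which lies in the subring
  \<open>A\<close>.\<close>

lemma submodule_over_iff:
  assumes "subring A R"
  shows "submodule_over A R I \<longleftrightarrow>
    I \<subseteq> carrier R \<and> \<zero> \<in> I \<and> (\<forall>x\<in>I. \<forall>y\<in>I. x \<oplus> y \<in> I) \<and> (\<forall>a\<in>A. \<forall>x\<in>I. a \<otimes> x \<in> I)"
    (is "?l = ?r")
proof
  assume ?l
  then show ?r
    unfolding submodule_def submodule_axioms_def subgroup_def by (simp add: ring_as_module_def)
next
  assume r: ?r
  have neg: "\<ominus> x \<in> I" if "x \<in> I" for x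
  proof -
    have "\<ominus> \<one> \<in> A" by (rule subringE(5)[OF assms subringE(3)[OF assms]])
    then have "\<ominus> \<one> \<otimes> x \<in> I" using r that by blast
    moreover have "x \<in> carrier R" using r that by blast
    ultimately show ?thesis by (simp add: l_minus)
  qed
  have inv: "inv\<^bsub>add_monoid (ring_as_module R)\<^esub> x = \<ominus> x" for x
    by (simp add: a_inv_def m_inv_def ring_as_module_def)
  show ?l
    unfolding submodule_def submodule_axioms_def subgroup_def inv using r neg
    by (simp add: ring_as_module_def subset_iff)
qed

lemma submodule_overD:
  assumes "subring A R" "submodule_over A R I"
  shows "I \<subseteq> carrier R" "\<zero> \<in> I" "\<And>x y. x \<in> I \<Longrightarrow> y \<in> I \<Longrightarrow> x \<oplus> y \<in> I"
    "\<And>a x. a \<in> A \<Longrightarrow> x \<in> I \<Longrightarrow> a \<otimes> x \<in> I"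
  using assms submodule_over_iff by auto

lemma ideal_prod_subsetI:
  assumes "\<And>i j. i \<in> I \<Longrightarrow> j \<in> J \<Longrightarrow> i \<otimes> j \<in> T" "\<And>x y. x \<in> T \<Longrightarrow> y \<in> T \<Longrightarrow> x \<oplus> y \<in> T"
  shows "I \<cdot> J \<subseteq> T"
proof
  fix x assume "x \<in> I \<cdot> J" then show "x \<in> T" by induct (use assms in auto)
qed

lemma ideal_prod_closed: "I \<subseteq> carrier R \<Longrightarrow> J \<subseteq> carrier R \<Longrightarrow> I \<cdot> J \<subseteq> carrier R"
  by (rule ideal_prod_subsetI) auto

lemma ideal_prod_mono: "I \<subseteq> I' \<Longrightarrow> J \<subseteq> J' \<Longrightarrow> I \<cdot> J \<subseteq> I' \<cdot> J'"
  by (rule ideal_prod_subsetI) (auto intro: ideal_prod.intros)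

lemma ideal_prod_commute:
  assumes "I \<subseteq> carrier R" "J \<subseteq> carrier R" shows "I \<cdot> J = J \<cdot> I"
proof -
  have "I \<cdot> J \<subseteq> J \<cdot> I" if "I \<subseteq> carrier R" "J \<subseteq> carrier R" for I J
    by (rule ideal_prod_subsetI)
       (use that in \<open>auto intro: ideal_prod.sum\<close>, metis ideal_prod.prod m_comm subsetD)
  then show ?thesis using assms by blast
qed

lemma ideal_prod_assoc:
  assumes "I \<subseteq> carrier R" "J \<subseteq> carrier R" "K \<subseteq> carrier R"
  shows "(I \<cdot> J) \<cdot> K = I \<cdot> (J \<cdot> K)"
proof -
  have *: "(I \<cdot> J) \<cdot> K \<subseteq> I \<cdot> (J \<cdot> K)"
    if c: "I \<subseteq> carrier R" "J \<subseteq> carrier R" "K \<subseteq> carrier R" for I J K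
  proof (rule ideal_prod_subsetI)
    fix x k assume "x \<in> I \<cdot> J" "k \<in> K"
    then show "x \<otimes> k \<in> I \<cdot> (J \<cdot> K)"
    proof induct
      case (prod i j)
      then have "i \<otimes> j \<otimes> k = i \<otimes> (j \<otimes> k)" using c by (auto intro: m_assoc)
      then show ?case using prod by (auto intro: ideal_prod.prod)
    next
      case (sum s t)
      then have "(s \<oplus> t) \<otimes> k = s \<otimes> k \<oplus> t \<otimes> k"
        using c ideal_prod_closed[OF c(1,2)] by (auto intro: l_distr)
      then show ?case using sum by (auto intro: ideal_prod.sum)
    qed
  qed (auto intro: ideal_prod.sum)
  \<comment> \<open>Commutativity turns the reverse inclusion into the first one with the three
    factors in opposite order.\<close>
  have "I \<cdot> (J \<cdot> K) = (K \<cdot> J) \<cdot> I"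
    using assms ideal_prod_commute ideal_prod_closed by metis
  also have "\<dots> \<subseteq> K \<cdot> (J \<cdot> I)" using * assms by blast
  also have "\<dots> = (I \<cdot> J) \<cdot> K"
    using assms ideal_prod_commute ideal_prod_closed by metis
  finally show ?thesis using *[OF assms] by blast
qed

text \<open>The second factor is only a nonempty set, so that \<open>D \<cdot> F\<close> for a
  finite set \<open>F\<close> is the \<open>D\<close>-module generated by \<open>F\<close>. Scalars
  are absorbed by the first factor, and nonemptiness supplies the zero element.\<close>

lemma submodule_over_ideal_prod:
  assumes A: "subring A R" and I: "submodule_over A R I" and J: "J \<subseteq> carrier R" "J \<noteq> {}"
  shows "submodule_over A R (I \<cdot> J)"
  unfolding submodule_over_iff[OF A]
proof (intro conjI ballI)
  note I' = submodule_overD[OF A I]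
  have Ac: "A \<subseteq> carrier R" by (rule subringE(1)[OF A])
  show cl: "I \<cdot> J \<subseteq> carrier R" using I'(1) J(1) by (rule ideal_prod_closed)
  obtain j where j: "j \<in> J" using J(2) by blast
  then have "\<zero> \<otimes> j \<in> I \<cdot> J" using I'(2) by (auto intro: ideal_prod.prod)
  then show "\<zero> \<in> I \<cdot> J" using j J(1) by auto
  show "x \<oplus> y \<in> I \<cdot> J" if "x \<in> I \<cdot> J" "y \<in> I \<cdot> J" for x y
    using that by (rule ideal_prod.sum)
  show "a \<otimes> x \<in> I \<cdot> J" if a: "a \<in> A" and "x \<in> I \<cdot> J" for a x
    using that(2)
  proof induct
    case (prod i j)
    then have "a \<otimes> (i \<otimes> j) = (a \<otimes> i) \<otimes> j" using a Ac I'(1) J(1) by (metis m_assoc subsetD)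
    then show ?case using prod a I'(4) by (auto intro: ideal_prod.prod)
  next
    case (sum s t)
    then have "a \<otimes> (s \<oplus> t) = a \<otimes> s \<oplus> a \<otimes> t" using a Ac cl by (metis r_distr subsetD)
    then show ?case using sum by (auto intro: ideal_prod.sum)
  qed
qed

lemma submodule_over_subring:
  assumes "subring A R" "subring C R" "A \<subseteq> C"
  shows "submodule_over A R C"
  using assms subringE(1,2,6,7)[OF assms(2)] by (auto simp: submodule_over_iff)

lemma ideal_prod_one:
  assumes A: "subring A R" and I: "submodule_over A R I"
  shows "I \<cdot> A = I"
proof
  note I' = submodule_overD[OF A I]
  have Ac: "A \<subseteq> carrier R" by (rule subringE(1)[OF A])
  show "I \<cdot> A \<subseteq> I"
  proof (rule ideal_prod_subsetI)
    fix i a assume "i \<in> I" "a \<in> A"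
    moreover from this have "i \<otimes> a = a \<otimes> i" using I'(1) Ac by (auto intro: m_comm)
    ultimately show "i \<otimes> a \<in> I" using I'(4) by auto
  qed (rule I'(3))
  show "I \<subseteq> I \<cdot> A"
  proof
    fix i assume "i \<in> I"
    then have "i \<otimes> \<one> \<in> I \<cdot> A" using subringE(3)[OF A] by (auto intro: ideal_prod.prod)
    then show "i \<in> I \<cdot> A" using \<open>i \<in> I\<close> I'(1) by auto
  qed
qed

text \<open>The product is an \<open>A\<close>-module, so it contains all of \<open>A\<close> as
  soon as it contains 1.\<close>

lemma invertible_submoduleI:
  assumes A: "subring A R" and "submodule_over A R I" "submodule_over A R J"
    and IJ: "\<And>i j. i \<in> I \<Longrightarrow> j \<in> J \<Longrightarrow> i \<otimes> j \<in> A" and one: "\<one> \<in> I \<cdot> J"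
  shows "I \<cdot> J = A" "invertible_submodule A R I"
proof -
  note I' = submodule_overD[OF A assms(2)] and J' = submodule_overD[OF A assms(3)]
  have "I \<cdot> J \<subseteq> A"
    by (rule ideal_prod_subsetI) (use IJ subringE(7)[OF A] in auto)
  moreover have "A \<subseteq> I \<cdot> J"
  proof
    fix a assume a: "a \<in> A"
    have "submodule_over A R (I \<cdot> J)"
      using submodule_over_ideal_prod[OF A assms(2)] J' by blast
    then have "a \<otimes> \<one> \<in> I \<cdot> J" using a one submodule_overD(4)[OF A] by blast
    then show "a \<in> I \<cdot> J" using a subringE(1)[OF A] by auto
  qed
  ultimately show *: "I \<cdot> J = A" by blast
  show "invertible_submodule A R I"
    unfolding invertible_submodule_def using assms(2,3) * by blast
qed

text \<open>If 1 is the sum of i_s j_s, then x = sum of i_s (x j_s) for every x in \<open>K\<close>,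
  with coefficients x j_s in \<open>C\<close>: elements of \<open>I\<close> that occur in a dual
  basis already generate \<open>K\<close> over \<open>C\<close>.\<close>

lemma ideal_prod_ext_eqI:
  assumes C: "subring C R" and K: "submodule_over C R K" and I: "I \<subseteq> K"
    and J: "J \<subseteq> carrier R" and one: "\<one> \<in> I \<cdot> J"
    and KJ: "\<And>x y. x \<in> K \<Longrightarrow> y \<in> J \<Longrightarrow> x \<otimes> y \<in> C"
  shows "I \<cdot> C = K"
proof
  note K' = submodule_overD[OF C K]
  have Kc: "x \<in> carrier R" if "x \<in> K" for x using that K' by blast
  have Cc: "x \<in> carrier R" if "x \<in> C" for x using that subringE(1)[OF C] by blast
  have Jc: "x \<in> carrier R" if "x \<in> J" for x using that J by blast
  have Ic: "x \<in> carrier R" if "x \<in> I" for x using that I Kc by blast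
  have IJ: "I \<cdot> J \<subseteq> carrier R" using I J K'(1) by (intro ideal_prod_closed) auto
  show "I \<cdot> C \<subseteq> K"
  proof (rule ideal_prod_subsetI)
    fix i c assume "i \<in> I" "c \<in> C"
    then show "i \<otimes> c \<in> K" using I K'(4)[of c i] Kc Cc by (auto simp: m_comm)
  qed (rule K'(3))
  show "K \<subseteq> I \<cdot> C"
  proof
    fix x assume x: "x \<in> K"
    have "x \<otimes> z \<in> I \<cdot> C" if "z \<in> I \<cdot> J" for z
      using that
    proof induct
      case (prod i j)
      then have "x \<otimes> (i \<otimes> j) = i \<otimes> (x \<otimes> j)" using Kc[OF x] Ic Jc by (simp add: m_ac)
      then show ?case using prod KJ[OF x] by (auto intro: ideal_prod.prod)
    next
      case (sum z z')
      then have "x \<otimes> (z \<oplus> z') = x \<otimes> z \<oplus> x \<otimes> z'" using Kc[OF x] IJ by (intro r_distr) auto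
      then show ?case using sum by (auto intro: ideal_prod.sum)
    qed
    from this[OF one] show "x \<in> I \<cdot> C" using Kc[OF x] by simp
  qed
qed

lemma comm_group_inv_group:
  assumes A: "subring A R"
  shows "comm_group (inv_group A R)"
proof (rule comm_groupI)
  have Ac: "A \<subseteq> carrier R" by (rule subringE(1)[OF A])
  have AA: "submodule_over A R A" using submodule_over_subring[OF A A] by simp
  have inv: "submodule_over A R I" "I \<subseteq> carrier R"
    "\<exists>J. submodule_over A R J \<and> J \<subseteq> carrier R \<and> I \<cdot> J = A" 
    if "I \<in> carrier (inv_group A R)" for I
    using that submodule_overD(1)[OF A] by (auto simp: inv_group_def invertible_submodule_def)
  fix I assume I: "I \<in> carrier (inv_group A R)"
  note I' = inv[OF I]
  then obtain I2 where I2: "submodule_over A R I2" "I2 \<subseteq> carrier R" "I \<cdot> I2 = A" by blast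
  show "\<one>\<^bsub>inv_group A R\<^esub> \<otimes>\<^bsub>inv_group A R\<^esub> I = I"
    using ideal_prod_one[OF A I'(1)] ideal_prod_commute[OF Ac I'(2)] by (simp add: inv_group_def)
  have comm: "I2 \<cdot> I = A" using I2 I' ideal_prod_commute by auto
  then show "\<exists>J\<in>carrier (inv_group A R). J \<otimes>\<^bsub>inv_group A R\<^esub> I = \<one>\<^bsub>inv_group A R\<^esub>"
    using I2 I' by (auto simp: inv_group_def invertible_submodule_def)
  fix J assume J: "J \<in> carrier (inv_group A R)"
  note J' = inv[OF J]
  then obtain J2 where J2: "submodule_over A R J2" "J2 \<subseteq> carrier R" "J \<cdot> J2 = A" by blast
  show "I \<otimes>\<^bsub>inv_group A R\<^esub> J = J \<otimes>\<^bsub>inv_group A R\<^esub> I"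
    using ideal_prod_commute I' J' by (simp add: inv_group_def)
  have 0: "\<zero> \<in> J" "\<zero> \<in> J2" using J' J2 submodule_overD(2)[OF A] by auto
  have "(I \<cdot> J) \<cdot> (J2 \<cdot> I2) = I \<cdot> ((J \<cdot> J2) \<cdot> I2)"
    using I'(2) J'(2) I2(2) J2(2) by (simp add: ideal_prod_assoc ideal_prod_closed)
  also have "\<dots> = A"
    using J2 I2 ideal_prod_one[OF A I2(1)] ideal_prod_commute[OF Ac I2(2)] by simp
  finally have "(I \<cdot> J) \<cdot> (J2 \<cdot> I2) = A" .
  moreover have "submodule_over A R (I \<cdot> J)" "submodule_over A R (J2 \<cdot> I2)"
    using submodule_over_ideal_prod[OF A] I'(1) J'(2) J2(1) I2(2) 0
      submodule_overD(2)[OF A I2(1)] by blast+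
  ultimately show "I \<otimes>\<^bsub>inv_group A R\<^esub> J \<in> carrier (inv_group A R)"
    by (auto simp: inv_group_def invertible_submodule_def)
  fix K assume K: "K \<in> carrier (inv_group A R)"
  show "I \<otimes>\<^bsub>inv_group A R\<^esub> J \<otimes>\<^bsub>inv_group A R\<^esub> K = I \<otimes>\<^bsub>inv_group A R\<^esub> (J \<otimes>\<^bsub>inv_group A R\<^esub> K)"
    using I' J' inv[OF K] ideal_prod_assoc by (simp add: inv_group_def)
next
  have "submodule_over A R A" using submodule_over_subring[OF A A] by simp
  then show "\<one>\<^bsub>inv_group A R\<^esub> \<in> carrier (inv_group A R)"
    using ideal_prod_one[OF A] by (auto simp: inv_group_def invertible_submodule_def)
qed

end

section \<open>Descent along a square-zero step\<close>

text \<open>Here \<open>N N\<close> lies in \<open>A \<inter> N\<close>, so \<open>N\<close> becomes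
  an ideal of square zero once the ideal \<open>A \<inter> N\<close> of \<open>C\<close> is divided
  out. The sum in \<open>decomp\<close> need not be direct.\<close>

locale square_zero_step = cring R for R :: "('a, 'b) ring_scheme" (structure) +
  fixes A C N :: "'a set"
  assumes A: "subring A R" and C: "subring C R" and AC: "A \<subseteq> C" and NC: "N \<subseteq> C"
    and N_zero: "\<zero> \<in> N"
    and N_add: "\<And>m n. m \<in> N \<Longrightarrow> n \<in> N \<Longrightarrow> m \<oplus> n \<in> N"
    and N_mult: "\<And>c n. c \<in> C \<Longrightarrow> n \<in> N \<Longrightarrow> c \<otimes> n \<in> N"
    and NN: "\<And>m n. m \<in> N \<Longrightarrow> n \<in> N \<Longrightarrow> m \<otimes> n \<in> A"
    and decomp: "\<And>z. z \<in> C \<Longrightarrow> \<exists>a\<in>A. \<exists>n\<in>N. z = a \<oplus> n"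
begin

lemma C_carrier [intro, simp]: "x \<in> C \<Longrightarrow> x \<in> carrier R"
  using subringE(1)[OF C] by blast

lemma A_C [intro, simp]: "x \<in> A \<Longrightarrow> x \<in> C" using AC by blast
lemma N_C [intro, simp]: "x \<in> N \<Longrightarrow> x \<in> C" using NC by blast

lemma C_closed [intro, simp]:
  "\<zero> \<in> C" "\<one> \<in> C" "x \<in> C \<Longrightarrow> y \<in> C \<Longrightarrow> x \<oplus> y \<in> C" "x \<in> C \<Longrightarrow> y \<in> C \<Longrightarrow> x \<otimes> y \<in> C"
  "x \<in> C \<Longrightarrow> \<ominus> x \<in> C" "x \<in> C \<Longrightarrow> y \<in> C \<Longrightarrow> x \<ominus> y \<in> C"
  using subringE(2,3,5,6,7)[OF C] by (auto simp: a_minus_def)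

lemma A_closed [intro, simp]:
  "\<zero> \<in> A" "\<one> \<in> A" "x \<in> A \<Longrightarrow> y \<in> A \<Longrightarrow> x \<oplus> y \<in> A" "x \<in> A \<Longrightarrow> y \<in> A \<Longrightarrow> x \<otimes> y \<in> A"
  "x \<in> A \<Longrightarrow> \<ominus> x \<in> A" "x \<in> A \<Longrightarrow> y \<in> A \<Longrightarrow> x \<ominus> y \<in> A"
  using subringE(2,3,5,6,7)[OF A] by (auto simp: a_minus_def)

lemma N_closed [intro, simp]:
  "\<zero> \<in> N" "x \<in> N \<Longrightarrow> y \<in> N \<Longrightarrow> x \<oplus> y \<in> N" "c \<in> C \<Longrightarrow> x \<in> N \<Longrightarrow> c \<otimes> x \<in> N"
  "c \<in> C \<Longrightarrow> x \<in> N \<Longrightarrow> x \<otimes> c \<in> N"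
  "x \<in> N \<Longrightarrow> \<ominus> x \<in> N" "x \<in> N \<Longrightarrow> y \<in> N \<Longrightarrow> x \<ominus> y \<in> N"
proof -
  show r: "x \<otimes> c \<in> N" if "c \<in> C" "x \<in> N" for x c
    using N_mult[OF that] that by (simp add: m_comm)
  show m: "\<ominus> x \<in> N" if "x \<in> N" for x
    using N_mult[of "\<ominus> \<one>" x] that by (simp add: l_minus)
  show "x \<in> N \<Longrightarrow> y \<in> N \<Longrightarrow> x \<ominus> y \<in> N" using m N_add by (simp add: a_minus_def)
qed (use N_zero N_add N_mult in auto)

text \<open>\<open>A \<inter> N\<close> is an ideal of \<open>C\<close>, because \<open>C = A + N\<close> and \<open>N N \<subseteq> A\<close>.\<close>

lemma AN_mult [intro]:
  assumes "e \<in> A \<inter> N" "c \<in> C" shows "c \<otimes> e \<in> A \<inter> N"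
proof -
  obtain a n where an: "a \<in> A" "n \<in> N" "c = a \<oplus> n" using decomp assms by blast
  have "c \<otimes> e = a \<otimes> e \<oplus> n \<otimes> e" using an assms by (auto intro: l_distr)
  then have "c \<otimes> e \<in> A" using an assms NN by auto
  then show ?thesis using assms by auto
qed

text \<open>Equality in \<open>C / (A \<inter> N)\<close> without forming the quotient ring.
  Membership of both sides in \<open>C\<close> is part of the relation, so that chains of
  congruences carry their own side conditions.\<close>

definition cong :: "'a \<Rightarrow> 'a \<Rightarrow> bool" (infix \<open>\<doteq>\<close> 50) where
  "x \<doteq> y \<longleftrightarrow> x \<in> C \<and> y \<in> C \<and> x \<ominus> y \<in> A \<inter> N"

lemma cong_refl [simp]: "x \<in> C \<Longrightarrow> x \<doteq> x"
  by (simp add: cong_def a_minus_def r_neg)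

lemma congI: "x = y \<oplus> e \<Longrightarrow> y \<in> C \<Longrightarrow> e \<in> A \<inter> N \<Longrightarrow> x \<doteq> y"
proof -
  assume *: "x = y \<oplus> e" "y \<in> C" "e \<in> A \<inter> N"
  moreover have "y \<in> carrier R" "e \<in> carrier R" using * by auto
  then have "x \<ominus> y = e" unfolding *(1) by algebra
  ultimately show ?thesis by (auto simp: cong_def)
qed

lemma congE: "x \<doteq> y \<Longrightarrow> (\<And>e. e \<in> A \<inter> N \<Longrightarrow> x = y \<oplus> e \<Longrightarrow> x \<in> C \<Longrightarrow> y \<in> C \<Longrightarrow> thesis) \<Longrightarrow> thesis"
proof -
  assume *: "x \<doteq> y" and **: "\<And>e. e \<in> A \<inter> N \<Longrightarrow> x = y \<oplus> e \<Longrightarrow> x \<in> C \<Longrightarrow> y \<in> C \<Longrightarrow> thesis"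
  from * have c: "x \<in> carrier R" "y \<in> carrier R" by (auto simp: cong_def)
  then have "x = y \<oplus> (x \<ominus> y)" by algebra
  with * show thesis by (intro **[of "x \<ominus> y"]) (auto simp: cong_def)
qed

lemma cong_zero_iff: "x \<doteq> \<zero> \<longleftrightarrow> x \<in> A \<inter> N"
  by (auto simp: cong_def a_minus_def)

lemma cong_trans [trans]:
  assumes "x \<doteq> y" "y \<doteq> z" shows "x \<doteq> z"
proof -
  obtain e where e: "e \<in> A \<inter> N" "x = y \<oplus> e" "x \<in> C" "y \<in> C" using assms(1) by (rule congE)
  obtain f where f: "f \<in> A \<inter> N" "y = z \<oplus> f" "y \<in> C" "z \<in> C" using assms(2) by (rule congE)
  have "x = z \<oplus> (f \<oplus> e)" using e f by (simp add: a_assoc)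
  then show ?thesis by (rule congI) (use e f in auto)
qed

lemma cong_add:
  assumes "x \<doteq> y" "x' \<doteq> y'" shows "x \<oplus> x' \<doteq> y \<oplus> y'"
proof -
  obtain e where e: "e \<in> A \<inter> N" "x = y \<oplus> e" "x \<in> C" "y \<in> C" using assms(1) by (rule congE)
  obtain f where f: "f \<in> A \<inter> N" "x' = y' \<oplus> f" "x' \<in> C" "y' \<in> C" using assms(2) by (rule congE)
  have c: "e \<in> carrier R" "f \<in> carrier R" "y \<in> carrier R" "y' \<in> carrier R" using e f by auto
  have "x \<oplus> x' = (y \<oplus> y') \<oplus> (e \<oplus> f)" using c unfolding e(2) f(2) by algebra
  then show ?thesis by (rule congI) (use e f in auto)
qed

lemma cong_mult:
  assumes "x \<doteq> y" "c \<in> C" shows "c \<otimes> x \<doteq> c \<otimes> y"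
proof -
  obtain e where e: "e \<in> A \<inter> N" "x = y \<oplus> e" "x \<in> C" "y \<in> C" using assms(1) by (rule congE)
  have "c \<otimes> x = c \<otimes> y \<oplus> c \<otimes> e" using e assms by (auto simp: r_distr)
  then show ?thesis by (rule congI) (use e AN_mult assms in auto)
qed

lemma cong_multr: "x \<doteq> y \<Longrightarrow> c \<in> C \<Longrightarrow> x \<otimes> c \<doteq> y \<otimes> c"
  using cong_mult[of x y c] by (simp add: cong_def m_comm)

text \<open>A choice of representatives for the projection from \<open>C\<close> to
  \<open>C / A = N / (A \<inter> N)\<close>. Two decompositions of the same element have
  \<open>N\<close>-components that differ by an element of both \<open>N\<close> and
  \<open>A\<close>, so only the class modulo \<open>A \<inter> N\<close> matters.\<close>

definition npart :: "'a \<Rightarrow> 'a" where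
  "npart z = (SOME n. n \<in> N \<and> (\<exists>a\<in>A. z = a \<oplus> n))"

lemma npart:
  assumes "z \<in> C" shows "npart z \<in> N" "\<exists>a\<in>A. z = a \<oplus> npart z"
proof -
  have "\<exists>n. n \<in> N \<and> (\<exists>a\<in>A. z = a \<oplus> n)" using decomp[OF assms] by blast
  from someI_ex[OF this] show "npart z \<in> N" "\<exists>a\<in>A. z = a \<oplus> npart z" by (auto simp: npart_def)
qed

lemma npart_unique:
  assumes "z = a \<oplus> n" "a \<in> A" "n \<in> N" shows "npart z \<doteq> n"
proof -
  have z: "z \<in> C" using assms by auto
  obtain b where b: "b \<in> A" "z = b \<oplus> npart z" using npart(2)[OF z] by blast
  have c: "a \<in> carrier R" "n \<in> carrier R" "b \<in> carrier R" "npart z \<in> carrier R"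
    using assms b npart(1)[OF z] by auto
  have "npart z \<ominus> n = (b \<oplus> npart z) \<ominus> b \<ominus> n" using c by algebra
  also have "\<dots> = (a \<oplus> n) \<ominus> b \<ominus> n" using b(2) assms(1) by simp
  also have "\<dots> = a \<ominus> b" using c by algebra
  finally have "npart z \<ominus> n \<in> A" using assms b by auto
  then show ?thesis using npart(1)[OF z] assms by (auto simp: cong_def)
qed

lemma npart_N: "n \<in> N \<Longrightarrow> npart n \<doteq> n"
  by (rule npart_unique[of _ \<zero>]) auto

lemma npart_A: "a \<in> A \<Longrightarrow> npart a \<doteq> \<zero>"
  by (rule npart_unique[of _ a]) auto

lemma npart_add:
  assumes "x \<in> C" "y \<in> C" shows "npart (x \<oplus> y) \<doteq> npart x \<oplus> npart y"
proof -
  obtain a where a: "a \<in> A" "x = a \<oplus> npart x" using npart(2) assms by blast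
  obtain b where b: "b \<in> A" "y = b \<oplus> npart y" using npart(2) assms by blast
  have c: "a \<in> carrier R" "b \<in> carrier R" "npart x \<in> carrier R" "npart y \<in> carrier R"
    using a b assms npart(1) by auto
  have "x \<oplus> y = (a \<oplus> npart x) \<oplus> (b \<oplus> npart y)" using a b by simp
  also have "\<dots> = (a \<oplus> b) \<oplus> (npart x \<oplus> npart y)" using c by algebra
  finally show ?thesis by (rule npart_unique) (use a b assms npart(1) in auto)
qed

lemma npart_mult:
  assumes "x \<in> C" "y \<in> C" shows "npart (x \<otimes> y) \<doteq> npart x \<otimes> y \<oplus> x \<otimes> npart y"
proof -
  obtain a where a: "a \<in> A" "x = a \<oplus> npart x" using npart(2) assms by blast
  obtain b where b: "b \<in> A" "y = b \<oplus> npart y" using npart(2) assms by blast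
  define m n where "m = npart x" and "n = npart y"
  have mn: "m \<in> N" "n \<in> N" using npart(1) assms m_def n_def by auto
  have xy: "x = a \<oplus> m" "y = b \<oplus> n" using a b m_def n_def by auto
  have c: "a \<in> carrier R" "b \<in> carrier R" "m \<in> carrier R" "n \<in> carrier R"
    using a b mn by auto
  \<comment> \<open>The Leibniz expression counts m n twice. The surplus copy is moved to the
    \<open>A\<close>-component, where it is allowed because \<open>N N\<close> lies in
    \<open>A\<close>.\<close>
  have "x \<otimes> y = (a \<otimes> b \<ominus> m \<otimes> n) \<oplus> (m \<otimes> y \<oplus> x \<otimes> n)"
    using c unfolding xy by algebra
  then have "npart (x \<otimes> y) \<doteq> m \<otimes> y \<oplus> x \<otimes> n"
    by (rule npart_unique) (use a b mn assms NN in auto)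
  then show ?thesis by (simp add: m_def n_def)
qed

text \<open>
  Modulo \<open>A \<inter> N\<close>, the map \<^term>\<open>npart\<close> is an \<open>A\<close>-linear derivation of \<open>C\<close>. If \<open>z = \<Sum>\<^sub>i k\<^sub>i j\<^sub>i\<close> with
  \<open>k\<^sub>i \<in> K\<close> and \<open>j\<^sub>i \<in> J\<close>, then \<open>T x = \<Sum>\<^sub>i npart (x j\<^sub>i) k\<^sub>i\<close> has the properties below; for \<open>z = 1\<close> it is
  the connection on \<open>K\<close> induced by \<open>npart\<close>, and its horizontal elements form the descended module.
\<close>

definition connection :: "'a set \<Rightarrow> 'a set \<Rightarrow> 'a \<Rightarrow> ('a \<Rightarrow> 'a) \<Rightarrow> bool" where
  "connection K J z T \<longleftrightarrow> (\<forall>x\<in>K. T x \<in> N \<cdot> K) \<and>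
     (\<forall>x\<in>K. \<forall>x'\<in>K. \<forall>y\<in>J. T (x \<oplus> x') \<otimes> y \<doteq> T x \<otimes> y \<oplus> T x' \<otimes> y) \<and>
     (\<forall>a\<in>A. \<forall>x\<in>K. \<forall>y\<in>J. T (a \<otimes> x) \<otimes> y \<doteq> a \<otimes> (T x \<otimes> y)) \<and>
     (\<forall>u\<in>N \<cdot> K. \<forall>y\<in>J. T u \<otimes> y \<doteq> u \<otimes> y \<otimes> z)"

end

text \<open>The assumptions are symmetric in \<open>K\<close> and \<open>J\<close>, so that each
  result about \<open>K\<close> can be read for \<open>J\<close> as well. The relation for 1 enters
  later, as a statement about an element z of \<open>K \<cdot> J\<close>, which makes induction on z
  possible.\<close>

locale square_zero_pairing = square_zero_step +
  fixes K J :: "'a set"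
  assumes K: "submodule_over C R K" and J: "submodule_over C R J"
    and KJ: "\<And>x y. x \<in> K \<Longrightarrow> y \<in> J \<Longrightarrow> x \<otimes> y \<in> C"
begin

lemmas K' [intro, simp] = submodule_overD(2-4)[OF C K]
lemmas J' [intro, simp] = submodule_overD(2-4)[OF C J]
lemma K_carrier [intro, simp]: "x \<in> K \<Longrightarrow> x \<in> carrier R" using submodule_overD(1)[OF C K] by blast
lemma J_carrier [intro, simp]: "x \<in> J \<Longrightarrow> x \<in> carrier R" using submodule_overD(1)[OF C J] by blast
declare KJ [intro, simp]

lemma NK_K [intro, simp]: "u \<in> N \<cdot> K \<Longrightarrow> u \<in> K"
proof -
  have "N \<cdot> K \<subseteq> K" by (rule ideal_prod_subsetI) auto
  then show "u \<in> N \<cdot> K \<Longrightarrow> u \<in> K" by blast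
qed

lemma NKJ [intro, simp]: "u \<in> N \<cdot> K \<Longrightarrow> y \<in> J \<Longrightarrow> u \<otimes> y \<in> N"
proof (induct rule: ideal_prod.induct)
  case (prod n k)
  then have "n \<otimes> k \<otimes> y = n \<otimes> (k \<otimes> y)" by (auto intro: m_assoc)
  then show ?case using prod by auto
next
  case (sum s t)
  then have "(s \<oplus> t) \<otimes> y = s \<otimes> y \<oplus> t \<otimes> y" by (auto intro!: l_distr)
  then show ?case using sum by auto
qed

text \<open>Linearity over \<open>A\<close> holds because \<open>npart\<close> kills
  \<open>A\<close> modulo \<open>A \<inter> N\<close>. On \<open>N \<cdot> K\<close> the element u j
  already lies in \<open>N\<close>, so \<open>npart\<close> does not change it, and (u j)(k y) = (u
  y)(k j) produces the factor z = k j.\<close>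

lemma connection_prod:
  assumes k: "k \<in> K" and j: "j \<in> J"
  shows "connection K J (k \<otimes> j) (\<lambda>x. npart (x \<otimes> j) \<otimes> k)"
  unfolding connection_def
proof (intro conjI ballI)
  fix x assume x: "x \<in> K"
  then have wx: "npart (x \<otimes> j) \<in> N" using npart(1) j by blast
  then show "npart (x \<otimes> j) \<otimes> k \<in> N \<cdot> K" using k by (rule ideal_prod.prod)
  fix y assume y: "y \<in> J"
  have [simp]: "npart (x \<otimes> j) \<otimes> k \<otimes> y = npart (x \<otimes> j) \<otimes> (k \<otimes> y)" if "x \<in> K" for x
    using npart(1)[of "x \<otimes> j"] that k y j by (auto intro!: m_assoc)
  {
    fix x' assume x': "x' \<in> K"
    have wx': "npart (x' \<otimes> j) \<in> N" using npart(1) j x' by blast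
    have "(x \<oplus> x') \<otimes> j = x \<otimes> j \<oplus> x' \<otimes> j" using x x' j by (auto intro!: l_distr)
    then have "npart ((x \<oplus> x') \<otimes> j) \<doteq> npart (x \<otimes> j) \<oplus> npart (x' \<otimes> j)"
      using npart_add[of "x \<otimes> j" "x' \<otimes> j"] x x' j by auto
    then have "npart ((x \<oplus> x') \<otimes> j) \<otimes> (k \<otimes> y) \<doteq> (npart (x \<otimes> j) \<oplus> npart (x' \<otimes> j)) \<otimes> (k \<otimes> y)"
      using k y by (intro cong_multr) auto
    also have "(npart (x \<otimes> j) \<oplus> npart (x' \<otimes> j)) \<otimes> (k \<otimes> y) =
        npart (x \<otimes> j) \<otimes> (k \<otimes> y) \<oplus> npart (x' \<otimes> j) \<otimes> (k \<otimes> y)"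
      using wx wx' k y by (intro l_distr) auto
    finally show "npart ((x \<oplus> x') \<otimes> j) \<otimes> k \<otimes> y \<doteq> npart (x \<otimes> j) \<otimes> k \<otimes> y \<oplus> npart (x' \<otimes> j) \<otimes> k \<otimes> y"
      using x x' by simp
  }
  fix a assume a: "a \<in> A"
  have xj: "x \<otimes> j \<in> C" using x j by auto
  have "a \<otimes> x \<otimes> j = a \<otimes> (x \<otimes> j)" using a x j by (intro m_assoc) auto
  then have "npart (a \<otimes> x \<otimes> j) \<doteq> npart a \<otimes> (x \<otimes> j) \<oplus> a \<otimes> npart (x \<otimes> j)"
    using npart_mult[of a "x \<otimes> j"] a xj by auto
  also have "\<dots> \<doteq> \<zero> \<otimes> (x \<otimes> j) \<oplus> a \<otimes> npart (x \<otimes> j)"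
    by (intro cong_add cong_multr npart_A a xj cong_refl) (use a wx in auto)
  also have "\<dots> = a \<otimes> npart (x \<otimes> j)" using xj a wx by simp
  finally have "npart (a \<otimes> x \<otimes> j) \<otimes> (k \<otimes> y) \<doteq> a \<otimes> npart (x \<otimes> j) \<otimes> (k \<otimes> y)"
    using k y by (intro cong_multr) auto
  also have "\<dots> = a \<otimes> (npart (x \<otimes> j) \<otimes> (k \<otimes> y))"
    using a wx k y by (intro m_assoc) auto
  finally show "npart (a \<otimes> x \<otimes> j) \<otimes> k \<otimes> y \<doteq> a \<otimes> (npart (x \<otimes> j) \<otimes> k \<otimes> y)"
    using x a by simp
next
  fix u y assume u: "u \<in> N \<cdot> K" and y: "y \<in> J"
  have c: "npart (u \<otimes> j) \<in> N" using npart(1) u j by blast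
  have "npart (u \<otimes> j) \<doteq> u \<otimes> j" using u j by (intro npart_N) auto
  then have "npart (u \<otimes> j) \<otimes> (k \<otimes> y) \<doteq> u \<otimes> j \<otimes> (k \<otimes> y)"
    using k y by (intro cong_multr) auto
  also have "u \<otimes> j \<otimes> (k \<otimes> y) = u \<otimes> y \<otimes> (k \<otimes> j)"
    using NK_K[OF u] k y j by (simp add: m_ac)
  also have "npart (u \<otimes> j) \<otimes> (k \<otimes> y) = npart (u \<otimes> j) \<otimes> k \<otimes> y"
    using c k y by (intro m_assoc[symmetric]) auto
  finally show "npart (u \<otimes> j) \<otimes> k \<otimes> y \<doteq> u \<otimes> y \<otimes> (k \<otimes> j)" .
qed

text \<open>All conditions are additive in z and \<open>T\<close> together, which is the induction
  step from single products to arbitrary elements of \<open>K \<cdot> J\<close>.\<close>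

lemma connection_sum:
  assumes h: "connection K J z T" "connection K J z' T'" and z: "z \<in> C" "z' \<in> C"
  shows "connection K J (z \<oplus> z') (\<lambda>x. T x \<oplus> T' x)"
  unfolding connection_def
proof (intro conjI ballI)
  note h1 = h(1)[unfolded connection_def] and h2 = h(2)[unfolded connection_def]
  have d: "(T x \<oplus> T' x) \<otimes> y = T x \<otimes> y \<oplus> T' x \<otimes> y"
    and m: "T x \<otimes> y \<in> C" "T' x \<otimes> y \<in> C" if "x \<in> K" "y \<in> J" for x y
  proof -
    have "T x \<in> N \<cdot> K" "T' x \<in> N \<cdot> K" using that h1 h2 by blast+
    then show "(T x \<oplus> T' x) \<otimes> y = T x \<otimes> y \<oplus> T' x \<otimes> y" "T x \<otimes> y \<in> C" "T' x \<otimes> y \<in> C"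
      using that by (auto intro!: l_distr)
  qed
  fix x assume x: "x \<in> K"
  then show "T x \<oplus> T' x \<in> N \<cdot> K" using h1 h2 by (blast intro: ideal_prod.sum)
  fix y assume y: "y \<in> J"
  {
    fix x' assume x': "x' \<in> K"
    have "T (x \<oplus> x') \<otimes> y \<oplus> T' (x \<oplus> x') \<otimes> y
        \<doteq> (T x \<otimes> y \<oplus> T x' \<otimes> y) \<oplus> (T' x \<otimes> y \<oplus> T' x' \<otimes> y)"
      by (intro cong_add) (use h1 h2 x x' y in blast)+
    also have "\<dots> = (T x \<otimes> y \<oplus> T' x \<otimes> y) \<oplus> (T x' \<otimes> y \<oplus> T' x' \<otimes> y)"
      using m[OF x y] m[OF x' y] by (simp add: a_ac)
    finally show "(T (x \<oplus> x') \<oplus> T' (x \<oplus> x')) \<otimes> y \<doteq> (T x \<oplus> T' x) \<otimes> y \<oplus> (T x' \<oplus> T' x') \<otimes> y"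
      using x x' y d by simp
  }
  fix a assume a: "a \<in> A"
  have "T (a \<otimes> x) \<otimes> y \<oplus> T' (a \<otimes> x) \<otimes> y \<doteq> a \<otimes> (T x \<otimes> y) \<oplus> a \<otimes> (T' x \<otimes> y)"
    by (intro cong_add) (use h1 h2 a x y in blast)+
  also have "\<dots> = a \<otimes> (T x \<otimes> y \<oplus> T' x \<otimes> y)"
    using m[OF x y] a by (simp add: r_distr)
  finally show "(T (a \<otimes> x) \<oplus> T' (a \<otimes> x)) \<otimes> y \<doteq> a \<otimes> ((T x \<oplus> T' x) \<otimes> y)"
    using x a y d by simp
next
  fix u y assume u: "u \<in> N \<cdot> K" and y: "y \<in> J"
  note h1 = h(1)[unfolded connection_def] and h2 = h(2)[unfolded connection_def]
  have Tu: "T u \<in> N \<cdot> K" "T' u \<in> N \<cdot> K" using u h1 h2 by blast+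
  have "T u \<otimes> y \<oplus> T' u \<otimes> y \<doteq> u \<otimes> y \<otimes> z \<oplus> u \<otimes> y \<otimes> z'"
    by (intro cong_add) (use h1 h2 u y in blast)+
  also have "T u \<otimes> y \<oplus> T' u \<otimes> y = (T u \<oplus> T' u) \<otimes> y"
    using Tu y by (intro l_distr[symmetric]) auto
  also have "u \<otimes> y \<otimes> z \<oplus> u \<otimes> y \<otimes> z' = u \<otimes> y \<otimes> (z \<oplus> z')"
    using NK_K[OF u] y z by (simp add: r_distr)
  finally show "(T u \<oplus> T' u) \<otimes> y \<doteq> u \<otimes> y \<otimes> (z \<oplus> z')" .
qed

text \<open>The value \<open>T x\<close> depends on the choices made in \<open>npart\<close>.
  Pairing with \<open>J\<close> and working modulo \<open>A \<inter> N\<close> removes this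
  dependence, hence the test against every y instead of the equation
  \<open>T x = \<zero>\<close>.\<close>

definition horizontal :: "('a \<Rightarrow> 'a) \<Rightarrow> 'a set" where
  "horizontal T = {x \<in> K. \<forall>y\<in>J. T x \<otimes> y \<doteq> \<zero>}"

lemma horizontal_submodule:
  assumes h: "connection K J z T"
  shows "submodule_over A R (horizontal T)"
  unfolding submodule_over_iff[OF A]
proof (intro conjI ballI)
  note h = h[unfolded connection_def]
  show "horizontal T \<subseteq> carrier R" by (auto simp: horizontal_def)
  \<comment> \<open>The second alternative serves the zero element: \<open>T \<zero>\<close> need
    not be zero, but \<open>\<zero>\<close> is also a multiple by the scalar \<open>\<zero>\<close>,
    and \<open>A\<close>-linearity of \<open>T\<close> settles that case.\<close>
  have ac: "a \<otimes> x \<in> horizontal T" if a: "a \<in> A" and x: "x \<in> horizontal T \<or> x \<in> K \<and> a = \<zero>" for a x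
  proof -
    have xK: "x \<in> K" using x by (auto simp: horizontal_def)
    have "T (a \<otimes> x) \<otimes> y \<doteq> \<zero>" if y: "y \<in> J" for y
    proof -
      have "T x \<otimes> y \<in> C" using h xK y by auto
      then have "a \<otimes> (T x \<otimes> y) \<doteq> \<zero>"
        using x y a cong_mult[of "T x \<otimes> y" \<zero> a] by (auto simp: horizontal_def)
      moreover have "T (a \<otimes> x) \<otimes> y \<doteq> a \<otimes> (T x \<otimes> y)" using h a xK y by blast
      ultimately show ?thesis using cong_trans by blast
    qed
    then show ?thesis using xK a by (auto simp: horizontal_def)
  qed
  then show "\<And>a x. a \<in> A \<Longrightarrow> x \<in> horizontal T \<Longrightarrow> a \<otimes> x \<in> horizontal T" by blast
  show "\<zero> \<in> horizontal T" using ac[of \<zero> \<zero>] by auto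
  fix x x' assume x: "x \<in> horizontal T" "x' \<in> horizontal T"
  then have "T (x \<oplus> x') \<otimes> y \<doteq> \<zero>" if y: "y \<in> J" for y
  proof -
    have "T (x \<oplus> x') \<otimes> y \<doteq> T x \<otimes> y \<oplus> T x' \<otimes> y" using h x y by (auto simp: horizontal_def)
    also have "\<dots> \<doteq> \<zero> \<oplus> \<zero>" using x y by (intro cong_add) (auto simp: horizontal_def)
    finally show ?thesis by simp
  qed
  then show "x \<oplus> x' \<in> horizontal T" using x by (auto simp: horizontal_def)
qed

text \<open>On \<open>N \<cdot> K\<close> the map \<open>T\<close> acts as multiplication by z, so
  \<open>T (e \<otimes> x) \<otimes> y\<close> is congruent to e times an element of
  \<open>C\<close>, and \<open>A \<inter> N\<close> is an ideal of \<open>C\<close>.\<close>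

lemma horizontal_AN:
  assumes h: "connection K J z T" and z: "z \<in> C" and e: "e \<in> A \<inter> N" and x: "x \<in> K"
  shows "e \<otimes> x \<in> horizontal T"
proof -
  have u: "e \<otimes> x \<in> N \<cdot> K" using e x by (auto intro: ideal_prod.prod)
  have "T (e \<otimes> x) \<otimes> y \<doteq> \<zero>" if y: "y \<in> J" for y
  proof -
    have "T (e \<otimes> x) \<otimes> y \<doteq> e \<otimes> x \<otimes> y \<otimes> z" using h u y by (auto simp: connection_def)
    also have "e \<otimes> x \<otimes> y \<otimes> z = x \<otimes> y \<otimes> z \<otimes> e" using e x y z by (simp add: m_ac)
    also have "x \<otimes> y \<otimes> z \<otimes> e \<doteq> \<zero>" unfolding cong_zero_iff using e x y z by (intro AN_mult) auto
    finally show ?thesis .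
  qed
  then show ?thesis using NK_K[OF u] by (simp add: horizontal_def)
qed

text \<open>For z = 1 the map \<open>T\<close> takes values in \<open>N \<cdot> K\<close> and acts
  there as the identity, so up to the congruence it is a projection, and x - T x lies in its
  kernel.\<close>

lemma horizontal_decomp:
  assumes h: "connection K J \<one> T" and x: "x \<in> K"
  obtains p u where "p \<in> horizontal T" "u \<in> N \<cdot> K" "x = p \<oplus> u"
proof
  note h = h[unfolded connection_def]
  \<comment> \<open>The difference x - T x, written with the scalar -1 so that closure of
    \<open>K\<close> under sums and scalars applies.\<close>
  define p where "p = x \<oplus> \<ominus> \<one> \<otimes> T x"
  have Tx: "T x \<in> N \<cdot> K" using h x by blast
  have pK: "p \<in> K" using NK_K[OF Tx] x by (simp add: p_def)
  have "x \<in> carrier R" "T x \<in> carrier R" using NK_K[OF Tx] x by auto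
  then show xp: "x = p \<oplus> T x" unfolding p_def by algebra
  show "T x \<in> N \<cdot> K" by fact
  have "T p \<otimes> y \<doteq> \<zero>" if y: "y \<in> J" for y
  proof -
    have c: "T p \<otimes> y \<in> C" "T x \<otimes> y \<in> C" "T (T x) \<otimes> y \<in> C" using h pK x Tx y by auto
    have "T x \<otimes> y = T (p \<oplus> T x) \<otimes> y" using xp by simp
    also have "\<dots> \<doteq> T p \<otimes> y \<oplus> T (T x) \<otimes> y" using h pK NK_K[OF Tx] y by blast
    also have "\<dots> \<doteq> T p \<otimes> y \<oplus> T x \<otimes> y \<otimes> \<one>"
      by (intro cong_add cong_refl c) (use h Tx y in blast)
    finally have "T x \<otimes> y \<doteq> T p \<otimes> y \<oplus> T x \<otimes> y" using c by simp
    then obtain e where e: "e \<in> A \<inter> N" "T x \<otimes> y = T p \<otimes> y \<oplus> T x \<otimes> y \<oplus> e" by (rule congE)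
    have cc: "T p \<otimes> y \<in> carrier R" "T x \<otimes> y \<in> carrier R" "e \<in> carrier R" using c e(1) by auto
    have "T p \<otimes> y = (T p \<otimes> y \<oplus> T x \<otimes> y \<oplus> e) \<ominus> e \<ominus> T x \<otimes> y"
      using cc by algebra
    also have "\<dots> = T x \<otimes> y \<ominus> e \<ominus> T x \<otimes> y" using e(2) by simp
    also have "\<dots> = \<ominus> e" using cc by algebra
    finally show ?thesis using e(1) by (auto simp: cong_zero_iff)
  qed
  then show "p \<in> horizontal T" using pK by (simp add: horizontal_def)
qed

lemma swap: "square_zero_pairing R A C N J K"
proof (intro square_zero_pairing.intro square_zero_pairing_axioms.intro)
  show "x \<otimes> y \<in> C" if "x \<in> J" "y \<in> K" for x y
    using KJ[OF that(2,1)] m_comm[of x y] that by simp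
qed (rule K J square_zero_step_axioms)+

text \<open>For z = k j the regrouping (x y)(k j) = (x j)(y k) turns the Leibniz rule of
  \<open>npart\<close> into a product rule, with one summand for each of \<open>T\<close> and
  \<open>S\<close>. Keeping z general lets the sums be built up by induction; z = 1 is inserted at
  the end.\<close>

lemma connection_pair_exists:
  assumes "z \<in> K \<cdot> J"
  shows "\<exists>T S. connection K J z T \<and> connection J K z S \<and>
    (\<forall>x\<in>K. \<forall>y\<in>J. npart (x \<otimes> y \<otimes> z) \<doteq> T x \<otimes> y \<oplus> x \<otimes> S y)"
  using assms
proof induct
  interpret JK: square_zero_pairing R A C N J K by (rule swap)
  case (prod k j)
  have "npart (x \<otimes> y \<otimes> (k \<otimes> j)) \<doteq> npart (x \<otimes> j) \<otimes> k \<otimes> y \<oplus> x \<otimes> (npart (y \<otimes> k) \<otimes> j)"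
    if x: "x \<in> K" and y: "y \<in> J" for x y
  proof -
    have c: "x \<otimes> j \<in> C" "y \<otimes> k \<in> C" using x y prod by auto
    note cc = npart(1)[OF c(1)] npart(1)[OF c(2)]
    have "x \<otimes> y \<otimes> (k \<otimes> j) = x \<otimes> j \<otimes> (y \<otimes> k)" using x y prod by (simp add: m_ac)
    then have "npart (x \<otimes> y \<otimes> (k \<otimes> j)) \<doteq> npart (x \<otimes> j) \<otimes> (y \<otimes> k) \<oplus> x \<otimes> j \<otimes> npart (y \<otimes> k)"
      using npart_mult[OF c] by simp
    also have "\<dots> = npart (x \<otimes> j) \<otimes> k \<otimes> y \<oplus> x \<otimes> (npart (y \<otimes> k) \<otimes> j)"
      using cc x y prod by (simp add: m_ac)
    finally show ?thesis .
  qed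
  moreover have "connection J K (k \<otimes> j) (\<lambda>y. npart (y \<otimes> k) \<otimes> j)"
    using JK.connection_prod[OF prod(2,1)] m_comm[of k j] prod by simp
  ultimately show ?case using connection_prod[OF prod] by blast
next
  interpret JK: square_zero_pairing R A C N J K by (rule swap)
  case (sum z z')
  have "K \<cdot> J \<subseteq> C" by (rule ideal_prod_subsetI) auto
  then have z: "z \<in> C" "z' \<in> C" using sum by auto
  obtain T S where 1: "connection K J z T" "connection J K z S"
    "\<forall>x\<in>K. \<forall>y\<in>J. npart (x \<otimes> y \<otimes> z) \<doteq> T x \<otimes> y \<oplus> x \<otimes> S y" using sum by blast
  obtain T' S' where 2: "connection K J z' T'" "connection J K z' S'"
    "\<forall>x\<in>K. \<forall>y\<in>J. npart (x \<otimes> y \<otimes> z') \<doteq> T' x \<otimes> y \<oplus> x \<otimes> S' y" using sum by blast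
  have "npart (x \<otimes> y \<otimes> (z \<oplus> z')) \<doteq> (T x \<oplus> T' x) \<otimes> y \<oplus> x \<otimes> (S y \<oplus> S' y)"
    if x: "x \<in> K" and y: "y \<in> J" for x y
  proof -
    have "T x \<in> N \<cdot> K" "T' x \<in> N \<cdot> K" "S y \<in> N \<cdot> J" "S' y \<in> N \<cdot> J"
      using x y 1(1,2) 2(1,2) unfolding connection_def by simp_all
    then have "T x \<in> K" "T' x \<in> K" "S y \<in> J" "S' y \<in> J"
      using NK_K JK.NK_K by simp_all
    then have c: "T x \<in> carrier R" "T' x \<in> carrier R" "S y \<in> carrier R" "S' y \<in> carrier R"
      "x \<in> carrier R" "y \<in> carrier R" using x y by auto
    have xy: "x \<otimes> y \<otimes> z \<in> C" "x \<otimes> y \<otimes> z' \<in> C" using x y z by auto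
    have "x \<otimes> y \<otimes> (z \<oplus> z') = x \<otimes> y \<otimes> z \<oplus> x \<otimes> y \<otimes> z'"
      using x y z by (intro r_distr) auto
    then have "npart (x \<otimes> y \<otimes> (z \<oplus> z')) \<doteq> npart (x \<otimes> y \<otimes> z) \<oplus> npart (x \<otimes> y \<otimes> z')"
      using npart_add[OF xy] by simp
    also have "\<dots> \<doteq> (T x \<otimes> y \<oplus> x \<otimes> S y) \<oplus> (T' x \<otimes> y \<oplus> x \<otimes> S' y)"
      by (intro cong_add) (use 1 2 x y in blast)+
    also have "\<dots> = (T x \<oplus> T' x) \<otimes> y \<oplus> x \<otimes> (S y \<oplus> S' y)" using c by algebra
    finally show ?thesis .
  qed
  then show ?case using connection_sum[OF 1(1) 2(1) z] JK.connection_sum[OF 1(2) 2(2) z] by blast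
qed

text \<open>The horizontal elements of \<open>K\<close> and \<open>J\<close> are the descended
  module and its inverse. Their products lie in \<open>A\<close> by the product rule; the delicate
  point is that these products generate 1.\<close>

lemma descend:
  assumes "\<one> \<in> K \<cdot> J"
  shows "\<exists>I. invertible_submodule A R I \<and> I \<cdot> C = K"
proof -
  interpret JK: square_zero_pairing R A C N J K by (rule swap)
  obtain T S where T: "connection K J \<one> T" and S: "connection J K \<one> S"
    and TS: "\<And>x y. x \<in> K \<Longrightarrow> y \<in> J \<Longrightarrow> npart (x \<otimes> y \<otimes> \<one>) \<doteq> T x \<otimes> y \<oplus> x \<otimes> S y"
    using connection_pair_exists[OF assms] by blast
  let ?I = "horizontal T" and ?J = "JK.horizontal S"
  have I: "submodule_over A R ?I" and J: "submodule_over A R ?J"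
    using horizontal_submodule[OF T] JK.horizontal_submodule[OF S] .
  have IK: "x \<in> K" if "x \<in> ?I" for x using that by (simp add: horizontal_def)
  have JJ: "y \<in> J" if "y \<in> ?J" for y using that by (simp add: JK.horizontal_def)
  \<comment> \<open>For horizontal factors both terms of the product rule vanish modulo
    \<open>A \<inter> N\<close>, so the \<open>N\<close>-component of x y lies in \<open>A\<close>,
    and therefore so does x y.\<close>
  have IJ: "x \<otimes> y \<in> A" if x: "x \<in> ?I" and y: "y \<in> ?J" for x y
  proof -
    have xy: "x \<otimes> y \<in> C" using IK[OF x] JJ[OF y] by auto
    have "S y \<in> N \<cdot> J" using S JJ[OF y] unfolding connection_def by simp
    then have "S y \<in> J" by (rule JK.NK_K)
    then have "x \<otimes> S y = S y \<otimes> x" using IK[OF x] by (intro m_comm) auto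
    then have "x \<otimes> S y \<doteq> \<zero>" using y IK[OF x] by (simp add: JK.horizontal_def)
    moreover have "T x \<otimes> y \<doteq> \<zero>" using x JJ[OF y] by (simp add: horizontal_def)
    ultimately have "T x \<otimes> y \<oplus> x \<otimes> S y \<doteq> \<zero> \<oplus> \<zero>" by (rule cong_add[rotated])
    then have "npart (x \<otimes> y) \<doteq> \<zero>"
      using TS[OF IK[OF x] JJ[OF y]] cong_trans xy by auto
    then have "npart (x \<otimes> y) \<in> A" by (simp add: cong_zero_iff)
    then show ?thesis using npart(2)[OF xy] A_closed(3) by metis
  qed
  have IJs: "submodule_over A R (?I \<cdot> ?J)"
    using submodule_over_ideal_prod[OF A I] submodule_overD(1,2)[OF A J] by blast
  note IJ' = submodule_overD[OF A IJs]
  have "K \<cdot> J \<subseteq> {s \<oplus> n | s n. s \<in> ?I \<cdot> ?J \<and> n \<in> N}" (is "_ \<subseteq> ?X")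
  proof (rule ideal_prod_subsetI)
    fix x y assume x: "x \<in> K" and y: "y \<in> J"
    obtain p u where p: "p \<in> ?I" "u \<in> N \<cdot> K" "x = p \<oplus> u" using horizontal_decomp[OF T x] .
    obtain q v where q: "q \<in> ?J" "v \<in> N \<cdot> J" "y = q \<oplus> v" using JK.horizontal_decomp[OF S y] .
    have "p \<in> K" "u \<in> K" "q \<in> J" "v \<in> J" using p q IK JJ by auto
    then have "p \<in> carrier R" "u \<in> carrier R" "q \<in> carrier R" "v \<in> carrier R" by auto
    \<comment> \<open>The terms other than p q are grouped so that each has a factor in
      \<open>N \<cdot> K\<close> or \<open>N \<cdot> J\<close>; such products lie in
      \<open>N\<close>.\<close>
    then have "x \<otimes> y = p \<otimes> q \<oplus> (u \<otimes> q \<oplus> v \<otimes> x)" unfolding p(3) q(3) by algebra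
    moreover have "u \<otimes> q \<oplus> v \<otimes> x \<in> N" using p q x JJ by auto
    moreover have "p \<otimes> q \<in> ?I \<cdot> ?J" using p q by (auto intro: ideal_prod.prod)
    ultimately show "x \<otimes> y \<in> ?X" by blast
  next
    fix x y assume "x \<in> ?X" "y \<in> ?X"
    then obtain s n t m where *: "x = s \<oplus> n" "y = t \<oplus> m" "s \<in> ?I \<cdot> ?J" "t \<in> ?I \<cdot> ?J" "n \<in> N" "m \<in> N"
      by blast
    then have "s \<in> carrier R" "t \<in> carrier R" "n \<in> carrier R" "m \<in> carrier R"
      using IJ'(1) by auto
    then have "x \<oplus> y = (s \<oplus> t) \<oplus> (n \<oplus> m)" unfolding * by algebra
    then show "x \<oplus> y \<in> ?X" using * by (blast intro: ideal_prod.sum N_closed)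
  qed
  then obtain s n where sn: "\<one> = s \<oplus> n" "s \<in> ?I \<cdot> ?J" "n \<in> N" using assms by blast
  have "?I \<cdot> ?J \<subseteq> A" by (rule ideal_prod_subsetI) (use IJ in auto)
  then have s: "s \<in> A" using sn by blast
  have "s \<in> carrier R" "n \<in> carrier R" using s sn(3) by auto
  then have "n = \<one> \<ominus> s" unfolding sn(1) by algebra
  then have n: "n \<in> A \<inter> N" using s sn(3) by auto
  \<comment> \<open>One factor n goes to each side of k j: both n k and n j are horizontal because n
    lies in \<open>A \<inter> N\<close>. This needs the square of n, not n itself.\<close>
  have "n \<otimes> n \<otimes> z \<in> ?I \<cdot> ?J" if "z \<in> K \<cdot> J" for z
    using that
  proof induct
    case (prod k j)
    then have "n \<otimes> n \<otimes> (k \<otimes> j) = (n \<otimes> k) \<otimes> (n \<otimes> j)" using n by (simp add: m_ac)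
    also have "\<dots> \<in> ?I \<cdot> ?J"
      by (intro ideal_prod.prod horizontal_AN[OF T _ n] JK.horizontal_AN[OF S _ n]) (use prod in auto)
    finally show ?case .
  next
    case (sum z z')
    have "K \<cdot> J \<subseteq> C" by (rule ideal_prod_subsetI) auto
    then have "z \<in> C" "z' \<in> C" using sum by auto
    then have "n \<otimes> n \<otimes> (z \<oplus> z') = n \<otimes> n \<otimes> z \<oplus> n \<otimes> n \<otimes> z'"
      using n by (intro r_distr) auto
    then show ?case using sum by (auto intro: ideal_prod.sum)
  qed
  from this[OF assms] have nn: "n \<otimes> n \<in> ?I \<cdot> ?J" using n by auto
  \<comment> \<open>From 1 = s + n follows n = n s + n^2. The first term is an
    \<open>A\<close>-multiple of s and the second was just treated, so the error n also lies in the
    product of the horizontal modules.\<close>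
  have "n = n \<otimes> (s \<oplus> n)" using n sn(1) by (metis A_C C_carrier Int_iff r_one)
  also have "\<dots> = n \<otimes> s \<oplus> n \<otimes> n" using n s by (intro r_distr) auto
  also have "\<dots> \<in> ?I \<cdot> ?J" using nn n sn(2) IJ'(3,4) by blast
  finally have one: "\<one> \<in> ?I \<cdot> ?J" unfolding sn(1) using sn(2) by (rule ideal_prod.sum[rotated])
  have "invertible_submodule A R ?I"
    by (rule invertible_submoduleI(2)[OF A I J IJ one])
  moreover have "?I \<cdot> C = K"
    by (rule ideal_prod_ext_eqI[OF C K _ _ one]) (use IK JJ in auto)
  ultimately show ?thesis by blast
qed

end

lemma (in square_zero_step) square_zero_inv_ext_surj:
  assumes "invertible_submodule C R K"
  shows "\<exists>I. invertible_submodule A R I \<and> I \<cdot> C = K"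
proof -
  obtain J where inv: "submodule_over C R K" "submodule_over C R J" "K \<cdot> J = C"
    using assms by (auto simp: invertible_submodule_def)
  interpret square_zero_pairing R A C N K J
    by (intro square_zero_pairing.intro square_zero_pairing_axioms.intro square_zero_step_axioms inv)
       (use inv(3) in \<open>auto intro: ideal_prod.prod\<close>)
  show ?thesis by (rule descend) (simp add: inv(3))
qed

section \<open>Towers of elementary subintegral extensions\<close>

text \<open>This is the ring \<open>D[c]\<close> whenever c^2 lies in \<open>D\<close>. Linear
  expressions in c are easy to match coefficient by coefficient with Laurent polynomials.\<close>

definition adjoin :: "('a, 'b) ring_scheme \<Rightarrow> 'a set \<Rightarrow> 'a \<Rightarrow> 'a set" where
  "adjoin R D c = {a \<oplus>\<^bsub>R\<^esub> b \<otimes>\<^bsub>R\<^esub> c | a b. a \<in> D \<and> b \<in> D}"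

text \<open>The subrings reached from \<open>A\<close> by finitely many elementary steps inside
  \<open>C\<close>. Generating them inductively, without an indexed chain, allows steps to be
  appended to any ring already reached.\<close>

inductive_set towers :: "('a, 'b) ring_scheme \<Rightarrow> 'a set \<Rightarrow> 'a set \<Rightarrow> 'a set set"
  for R A C where
    base: "A \<in> towers R A C"
  | step: "D \<in> towers R A C \<Longrightarrow> c \<in> C \<Longrightarrow> c \<otimes>\<^bsub>R\<^esub> c \<in> D \<Longrightarrow> c \<otimes>\<^bsub>R\<^esub> (c \<otimes>\<^bsub>R\<^esub> c) \<in> D \<Longrightarrow>
      adjoin R D c \<in> towers R A C"

context cring begin

lemma adjoinI: "x = a \<oplus> b \<otimes> c \<Longrightarrow> a \<in> D \<Longrightarrow> b \<in> D \<Longrightarrow> x \<in> adjoin R D c"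
  by (auto simp: adjoin_def)

lemma adjoin_mono: "D \<subseteq> E \<Longrightarrow> adjoin R D c \<subseteq> adjoin R E c"
  by (auto simp: adjoin_def)

lemma adjoin_incl:
  assumes "subring D R" "c \<in> carrier R"
  shows "D \<subseteq> adjoin R D c" "c \<in> adjoin R D c"
proof -
  note D = subringE(1,2,3)[OF assms(1)]
  show "D \<subseteq> adjoin R D c"
  proof
    fix x assume x: "x \<in> D"
    then have "x = x \<oplus> \<zero> \<otimes> c" using D assms by auto
    then show "x \<in> adjoin R D c" using x D by (intro adjoinI)
  qed
  have "c = \<zero> \<oplus> \<one> \<otimes> c" using assms by simp
  then show "c \<in> adjoin R D c" using D by (intro adjoinI)
qed

lemma subring_adjoin:
  assumes D: "subring D R" and c: "c \<in> carrier R" "c \<otimes> c \<in> D"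
  shows "subring (adjoin R D c) R"
proof (rule subringI)
  note Dc = subsetD[OF subringE(1)[OF D]]
  note cl = subringE(2,3,5,6,7)[OF D]
  show "adjoin R D c \<subseteq> carrier R" using c Dc by (auto simp: adjoin_def)
  show "\<one> \<in> adjoin R D c" using adjoin_incl(1)[OF D c(1)] cl by blast
  fix x assume "x \<in> adjoin R D c"
  then obtain a b where x: "x = a \<oplus> b \<otimes> c" "a \<in> D" "b \<in> D" by (auto simp: adjoin_def)
  have xc: "a \<in> carrier R" "b \<in> carrier R" using x Dc by auto
  have "\<ominus> x = \<ominus> a \<oplus> \<ominus> b \<otimes> c" using xc c(1) unfolding x(1) by algebra
  then show "\<ominus> x \<in> adjoin R D c" by (rule adjoinI) (simp_all add: x cl)
  fix y assume "y \<in> adjoin R D c"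
  then obtain a' b' where y: "y = a' \<oplus> b' \<otimes> c" "a' \<in> D" "b' \<in> D" by (auto simp: adjoin_def)
  have yc: "a' \<in> carrier R" "b' \<in> carrier R" using y Dc by auto
  have "x \<oplus> y = (a \<oplus> a') \<oplus> (b \<oplus> b') \<otimes> c" using xc yc c(1) unfolding x(1) y(1) by algebra
  then show "x \<oplus> y \<in> adjoin R D c" by (rule adjoinI) (simp_all add: x y cl)
  have "x \<otimes> y = (a \<otimes> a' \<oplus> b \<otimes> b' \<otimes> (c \<otimes> c)) \<oplus> (a \<otimes> b' \<oplus> b \<otimes> a') \<otimes> c"
    using xc yc c(1) unfolding x(1) y(1) by algebra
  moreover have "a \<otimes> a' \<oplus> b \<otimes> b' \<otimes> (c \<otimes> c) \<in> D" "a \<otimes> b' \<oplus> b \<otimes> a' \<in> D"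
    using x y c cl by auto
  ultimately show "x \<otimes> y \<in> adjoin R D c" by (rule adjoinI)
qed

lemma adjoin_eq_generate_ring:
  assumes D: "subring D R" and c: "c \<in> carrier R" "c \<otimes> c \<in> D"
  shows "generate_ring R (insert c D) = adjoin R D c"
proof (rule generate_ringI[symmetric])
  show "subring (adjoin R D c) R" using assms by (rule subring_adjoin)
  show "insert c D \<subseteq> adjoin R D c" using adjoin_incl[OF D c(1)] by blast
  show "adjoin R D c \<subseteq> E" if "subring E R" "insert c D \<subseteq> E" for E
    using that(2) subringE(6,7)[OF that(1)] by (auto simp: adjoin_def subset_iff)
qed (use subringE(1)[OF D] c in auto)

text \<open>The set is the principal ideal c D[c] = D c + D c^2. A product of two of its elements
  involves only c^2, c^3 and c^4 = (c^2)^2, all with coefficients in \<open>D\<close>.\<close>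

lemma square_zero_step_adjoin:
  assumes D: "subring D R" and c: "c \<in> carrier R" "c \<otimes> c \<in> D" "c \<otimes> (c \<otimes> c) \<in> D"
  shows "square_zero_step R D (adjoin R D c) {a \<otimes> c \<oplus> b \<otimes> (c \<otimes> c) | a b. a \<in> D \<and> b \<in> D}"
    (is "square_zero_step R D ?E ?N")
proof (intro square_zero_step.intro square_zero_step_axioms.intro)
  note Dc = subsetD[OF subringE(1)[OF D]]
  note cl = subringE(2,3,5,6,7)[OF D]
  show "cring R" by (rule cring_axioms)
  show "subring D R" by fact
  show "subring ?E R" using D c(1,2) by (rule subring_adjoin)
  show "D \<subseteq> ?E" using adjoin_incl(1)[OF D c(1)] .
  show "?N \<subseteq> ?E"
  proof
    fix n assume "n \<in> ?N"
    then obtain a b where n: "n = a \<otimes> c \<oplus> b \<otimes> (c \<otimes> c)" "a \<in> D" "b \<in> D" by blast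
    then have "n = b \<otimes> (c \<otimes> c) \<oplus> a \<otimes> c" using Dc c(1) by (simp add: a_comm)
    moreover have "b \<otimes> (c \<otimes> c) \<in> D" using n c cl by auto
    ultimately show "n \<in> ?E" using n by (intro adjoinI)
  qed
  have "\<zero> = \<zero> \<otimes> c \<oplus> \<zero> \<otimes> (c \<otimes> c)" using c(1) by simp
  then show "\<zero> \<in> ?N" using cl by blast
  show "\<exists>a\<in>D. \<exists>n\<in>?N. z = a \<oplus> n" if "z \<in> ?E" for z
  proof -
    obtain a b where z: "z = a \<oplus> b \<otimes> c" "a \<in> D" "b \<in> D" using \<open>z \<in> ?E\<close> unfolding adjoin_def by blast
    have "b \<otimes> c = b \<otimes> c \<oplus> \<zero> \<otimes> (c \<otimes> c)" using z Dc c(1) by simp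
    then have "b \<otimes> c \<in> ?N" using z cl(1) by blast
    then show ?thesis using z by blast
  qed
  fix m n assume n: "n \<in> ?N"
  then obtain a b where n: "n = a \<otimes> c \<oplus> b \<otimes> (c \<otimes> c)" "a \<in> D" "b \<in> D" by blast
  have nc: "a \<in> carrier R" "b \<in> carrier R" using n Dc by auto
  show "m \<otimes> n \<in> ?N" if "m \<in> ?E"
  proof -
    obtain d e where m: "m = d \<oplus> e \<otimes> c" "d \<in> D" "e \<in> D" using \<open>m \<in> ?E\<close> unfolding adjoin_def by blast
    have mc: "d \<in> carrier R" "e \<in> carrier R" using m Dc by auto
    have mn: "m \<otimes> n = (d \<otimes> a \<oplus> e \<otimes> b \<otimes> (c \<otimes> c)) \<otimes> c \<oplus> (d \<otimes> b \<oplus> e \<otimes> a) \<otimes> (c \<otimes> c)"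
      using nc mc c(1) unfolding m(1) n(1) by algebra
    moreover have "d \<otimes> a \<oplus> e \<otimes> b \<otimes> (c \<otimes> c) \<in> D" "d \<otimes> b \<oplus> e \<otimes> a \<in> D"
      using m n c cl by auto
    ultimately show ?thesis using mn by blast
  qed
  assume "m \<in> ?N"
  then obtain a' b' where m: "m = a' \<otimes> c \<oplus> b' \<otimes> (c \<otimes> c)" "a' \<in> D" "b' \<in> D" by blast
  have mc: "a' \<in> carrier R" "b' \<in> carrier R" using m Dc by auto
  have "m \<oplus> n = (a' \<oplus> a) \<otimes> c \<oplus> (b' \<oplus> b) \<otimes> (c \<otimes> c)"
    using nc mc c(1) unfolding m(1) n(1) by algebra
  moreover have "a' \<oplus> a \<in> D" "b' \<oplus> b \<in> D" using m n cl by auto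
  ultimately show "m \<oplus> n \<in> ?N" by blast
  have "m \<otimes> n = a' \<otimes> a \<otimes> (c \<otimes> c) \<oplus> (a' \<otimes> b \<oplus> b' \<otimes> a) \<otimes> (c \<otimes> (c \<otimes> c)) \<oplus>
      b' \<otimes> b \<otimes> ((c \<otimes> c) \<otimes> (c \<otimes> c))"
    using nc mc c(1) unfolding m(1) n(1) by algebra
  then show "m \<otimes> n \<in> D" using m n c cl by auto
qed

lemma adjoin_subset:
  assumes "subring C R" "D \<subseteq> C" "c \<in> C"
  shows "adjoin R D c \<subseteq> C"
  using subringE(6,7)[OF assms(1)] assms(2,3) by (auto simp: adjoin_def subset_iff)

lemma towers_subring:
  assumes "subring A R" "subring C R" "A \<subseteq> C" "D \<in> towers R A C"
  shows "subring D R \<and> A \<subseteq> D \<and> D \<subseteq> C"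
  using assms(4)
proof induct
  case (step D c)
  have c: "c \<in> carrier R" using step(3) subringE(1)[OF assms(2)] by blast
  have D: "subring D R" "A \<subseteq> D" "D \<subseteq> C" using step(2) by auto
  show ?case
    using subring_adjoin[OF D(1) c step(4)] adjoin_incl(1)[OF D(1) c] D(2)
      adjoin_subset[OF assms(2) D(3) step(3)] by auto
qed (use assms in auto)

text \<open>The steps leading to \<open>D'\<close> are replayed on top of \<open>D\<close>: if c^2
  and c^3 lie in \<open>D'\<close>, they lie in every larger ring \<open>E\<close>, so c may be
  adjoined to \<open>E\<close> too.\<close>

lemma towers_directed:
  assumes AC: "subring A R" "subring C R" "A \<subseteq> C" and D: "D \<in> towers R A C"
    and D': "D' \<in> towers R A C"
  shows "\<exists>E\<in>towers R A C. D \<subseteq> E \<and> D' \<subseteq> E"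
  using D'
proof induct
  case base
  show ?case using D towers_subring[OF AC D] by auto
next
  case (step D' c)
  then obtain E where E: "E \<in> towers R A C" "D \<subseteq> E" "D' \<subseteq> E" by auto
  have c: "c \<in> carrier R" using step(3) subringE(1)[OF AC(2)] by auto
  have Es: "subring E R" using towers_subring[OF AC E(1)] by simp
  have "adjoin R E c \<in> towers R A C"
    by (rule towers.step) (use E step in auto)
  moreover have "E \<subseteq> adjoin R E c" by (rule adjoin_incl(1)[OF Es c])
  ultimately show ?case using E(2) adjoin_mono[OF E(3), of c] by blast
qed

lemma towers_finite:
  assumes AC: "subring A R" "subring C R" "A \<subseteq> C"
    and cover: "\<And>c. c \<in> C \<Longrightarrow> \<exists>D\<in>towers R A C. c \<in> D"
    and F: "finite F" "F \<subseteq> C"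
  shows "\<exists>D\<in>towers R A C. F \<subseteq> D"
  using F
proof induct
  case empty
  show ?case using towers.base by fast
next
  case (insert c F)
  from insert obtain D where D: "D \<in> towers R A C" "F \<subseteq> D" by auto
  from insert obtain D' where D': "D' \<in> towers R A C" "c \<in> D'" using cover[of c] by auto
  obtain E where "E \<in> towers R A C" "D \<subseteq> E" "D' \<subseteq> E"
    using towers_directed[OF AC D(1) D'(1)] by auto
  then show ?case using D(2) D'(2) by (intro bexI[of _ E]) auto
qed

lemma subintegral_towers:
  assumes "subintegral R A C" "c \<in> C"
  shows "\<exists>D\<in>towers R A C. c \<in> D"
proof -
  obtain r :: nat and D where D: "D 0 = A" "D r \<subseteq> C" "c \<in> D r"
    "\<And>i. i \<in> {1..r} \<Longrightarrow> elementary_subintegral R (D (i - 1)) (D i)"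
    using assms unfolding subintegral_def by blast
  have elem: "elementary_subintegral R (D i) (D (Suc i))" if "i < r" for i
    using D(4)[of "Suc i"] that by simp
  \<comment> \<open>Only the last ring of the chain is assumed to lie in \<open>C\<close>, whereas
    each adjoined element of a tower must; monotonicity of the chain bridges this.\<close>
  have sub: "D i \<subseteq> D r" if "i \<le> r" for i
    using that
  proof (induct rule: inc_induct)
    case (step n)
    show ?case using step elem[of n] unfolding elementary_subintegral_def by blast
  qed simp
  have "i \<le> r \<Longrightarrow> D i \<in> towers R A C" for i
  proof (induct i)
    case 0
    then show ?case by (simp add: D(1) towers.base)
  next
    case (Suc i)
    obtain x where x: "subring (D i) R" "subring (D (Suc i)) R" "x \<in> D (Suc i)"
      "x [^] (2::nat) \<in> D i" "x [^] (3::nat) \<in> D i"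
      "D (Suc i) = generate_ring R (insert x (D i))"
      using elem[of i] Suc unfolding elementary_subintegral_def by auto
    have xc: "x \<in> carrier R" using x(3) subringE(1)[OF x(2)] by auto
    then have pow: "x [^] (2::nat) = x \<otimes> x" "x [^] (3::nat) = x \<otimes> (x \<otimes> x)"
      by (simp_all add: numeral_eq_Suc m_assoc)
    have "x \<in> C" using x(3) sub[OF Suc.prems] D(2) by blast
    have "adjoin R (D i) x \<in> towers R A C"
      by (rule towers.step) (use Suc x(4,5) pow \<open>x \<in> C\<close> in auto)
    then show ?case using adjoin_eq_generate_ring[OF x(1) xc] x pow by simp
  qed
  then show ?thesis using D(3) by blast
qed

text \<open>The module is descended from the top of the tower, one square-zero step at a time, which
  is why the induction must range over all \<open>K\<close>. The extensions compose because
  \<open>D \<cdot> D[c] = D[c]\<close>.\<close>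

lemma towers_inv_ext_surj:
  assumes sub: "subring A R" "subring C R" "A \<subseteq> C" and D: "D \<in> towers R A C"
    and K: "invertible_submodule D R K"
  shows "\<exists>I. invertible_submodule A R I \<and> I \<cdot> D = K"
  using D K
proof (induct arbitrary: K)
  case base
  then show ?case using ideal_prod_one[OF sub(1)] by (auto simp: invertible_submodule_def)
next
  case (step D c)
  have c: "c \<in> carrier R" using step(3) subringE(1)[OF sub(2)] by auto
  have D: "subring D R" using towers_subring[OF sub step(1)] by simp
  interpret square_zero_step R D "adjoin R D c" "{a \<otimes> c \<oplus> b \<otimes> (c \<otimes> c) | a b. a \<in> D \<and> b \<in> D}"
    using D c step by (intro square_zero_step_adjoin)
  obtain L where L: "invertible_submodule D R L" "L \<cdot> adjoin R D c = K"
    using square_zero_inv_ext_surj step by blast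
  then obtain I where I: "invertible_submodule A R I" "I \<cdot> D = L" using step by blast
  have Ic: "I \<subseteq> carrier R"
    using I(1) submodule_overD(1)[OF sub(1)] by (auto simp: invertible_submodule_def)
  have "D \<cdot> adjoin R D c = adjoin R D c"
    using ideal_prod_one[OF D submodule_over_subring[OF D C AC]] subringE(1)[OF D] subringE(1)[OF C]
      ideal_prod_commute by simp
  then have "I \<cdot> adjoin R D c = K"
    using ideal_prod_assoc[OF Ic, of D "adjoin R D c"] I(2) L(2) subringE(1)[OF D] subringE(1)[OF C]
    by simp
  then show ?case using I(1) by blast
qed

text \<open>Two finite sets replace the indexed sum of products.\<close>

lemma ideal_prod_finite:
  assumes "z \<in> K \<cdot> J"
  shows "\<exists>K0 J0. finite K0 \<and> finite J0 \<and> K0 \<subseteq> K \<and> J0 \<subseteq> J \<and> z \<in> K0 \<cdot> J0"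
  using assms
proof induct
  case (prod k j)
  have "k \<otimes> j \<in> {k} \<cdot> {j}" by (rule ideal_prod.prod) auto
  then show ?case using prod by (intro exI[of _ "{k}"] exI[of _ "{j}"]) auto
next
  case (sum z z')
  obtain K0 J0 where 0: "finite K0" "finite J0" "K0 \<subseteq> K" "J0 \<subseteq> J" "z \<in> K0 \<cdot> J0"
    using sum(2) by auto
  obtain K1 J1 where 1: "finite K1" "finite J1" "K1 \<subseteq> K" "J1 \<subseteq> J" "z' \<in> K1 \<cdot> J1"
    using sum(4) by auto
  have "z \<oplus> z' \<in> (K0 \<union> K1) \<cdot> (J0 \<union> J1)"
    by (rule ideal_prod.sum; rule subsetD[OF ideal_prod_mono])
       (use 0(5) 1(5) in auto)
  then show ?case using 0 1 by (intro exI[of _ "K0 \<union> K1"] exI[of _ "J0 \<union> J1"]) auto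
qed

text \<open>With 1 in \<open>K0 \<cdot> J0\<close> for finite sets, one tower ring \<open>D\<close>
  contains all products k j. Then \<open>D \<cdot> K0\<close> and \<open>D \<cdot> J0\<close> are
  inverse to each other over \<open>D\<close>, \<open>D \<cdot> K0\<close> extends to
  \<open>K\<close>, and it descends along the tower. The hypothesis \<open>cover\<close> speaks of
  finite sets so that Laurent rings are covered by the same argument.\<close>

lemma inv_ext_surj:
  assumes AC: "subring A R" "subring C R" "A \<subseteq> C"
    and cover: "\<And>F. finite F \<Longrightarrow> F \<subseteq> C \<Longrightarrow> \<exists>D\<in>towers R A C. F \<subseteq> D"
    and K: "invertible_submodule C R K"
  shows "\<exists>I. invertible_submodule A R I \<and> I \<cdot> C = K"
proof -
  obtain J where KJ: "submodule_over C R K" "submodule_over C R J" "K \<cdot> J = C"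
    using K by (auto simp: invertible_submodule_def)
  note K' = submodule_overD[OF AC(2) KJ(1)] and J' = submodule_overD[OF AC(2) KJ(2)]
  have "\<one> \<in> K \<cdot> J" using KJ(3) subringE(3)[OF AC(2)] by simp
  then obtain K0 J0 where fin: "finite K0" "finite J0" and sub: "K0 \<subseteq> K" "J0 \<subseteq> J"
    and one: "\<one> \<in> K0 \<cdot> J0" using ideal_prod_finite[of \<one> K J] by auto
  \<comment> \<open>Nonemptiness puts zero into \<open>D \<cdot> K0\<close> and
    \<open>D \<cdot> J0\<close>, so that both are modules.\<close>
  have ne: "K0 \<noteq> {}" "J0 \<noteq> {}"
    using one by (induct rule: ideal_prod.induct) auto
  have c: "K0 \<subseteq> carrier R" "J0 \<subseteq> carrier R" using sub K' J' by auto
  have kjC: "k \<otimes> j \<in> C" if "k \<in> K" "j \<in> J" for k j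
    using KJ(3) that ideal_prod.prod[of k K j J R] by simp
  have "\<exists>D\<in>towers R A C. (\<lambda>(k, j). k \<otimes> j) ` (K0 \<times> J0) \<subseteq> D"
    by (rule cover) (use fin sub kjC in auto)
  then obtain D where D: "D \<in> towers R A C" and kj: "\<And>k j. k \<in> K0 \<Longrightarrow> j \<in> J0 \<Longrightarrow> k \<otimes> j \<in> D"
    by auto
  have Ds: "subring D R" "D \<subseteq> C" using towers_subring[OF AC D] by auto
  note Dc = subringE(1)[OF Ds(1)]
  have DD: "submodule_over D R D" using submodule_over_subring[OF Ds(1) Ds(1)] by simp
  have subm: "submodule_over D R (D \<cdot> K0)" "submodule_over D R (D \<cdot> J0)"
    using submodule_over_ideal_prod[OF Ds(1) DD] c ne by auto
  have cl: "D \<cdot> K0 \<subseteq> carrier R" "D \<cdot> J0 \<subseteq> carrier R" "K0 \<cdot> J0 \<subseteq> carrier R"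
    by (intro ideal_prod_closed Dc c)+
  have "(D \<cdot> K0) \<cdot> (D \<cdot> J0) = D \<cdot> ((D \<cdot> J0) \<cdot> K0)"
    using ideal_prod_assoc[OF Dc c(1) cl(2)] ideal_prod_commute[OF c(1) cl(2)] by simp
  also have "\<dots> = D \<cdot> (D \<cdot> (K0 \<cdot> J0))"
    using ideal_prod_assoc[OF Dc c(2,1)] ideal_prod_commute[OF c] by simp
  also have "\<dots> \<subseteq> D"
  proof -
    have "K0 \<cdot> J0 \<subseteq> D" by (rule ideal_prod_subsetI) (use kj subringE(7)[OF Ds(1)] in auto)
    then have "D \<cdot> (D \<cdot> (K0 \<cdot> J0)) \<subseteq> D \<cdot> (D \<cdot> D)" by (intro ideal_prod_mono) auto
    then show ?thesis by (simp add: ideal_prod_one[OF Ds(1) DD])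
  qed
  finally have prodD: "(D \<cdot> K0) \<cdot> (D \<cdot> J0) \<subseteq> D" .
  have incl: "S \<subseteq> D \<cdot> S" if "S \<subseteq> carrier R" for S
  proof
    fix s assume s: "s \<in> S"
    then have "\<one> \<otimes> s \<in> D \<cdot> S" using subringE(3)[OF Ds(1)] by (rule ideal_prod.prod[rotated])
    then show "s \<in> D \<cdot> S" using s that by auto
  qed
  have one': "\<one> \<in> (D \<cdot> K0) \<cdot> (D \<cdot> J0)"
    by (rule subsetD[OF ideal_prod_mono one]) (intro incl c)+
  have invD: "invertible_submodule D R (D \<cdot> K0)"
    by (rule invertible_submoduleI(2)[OF Ds(1) subm _ one']) (rule subsetD[OF prodD], rule ideal_prod.prod)
  have K0: "D \<cdot> K0 \<subseteq> K" "D \<cdot> J0 \<subseteq> J"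
    by (rule ideal_prod_subsetI; use Ds(2) K' J' sub in \<open>simp add: subset_iff\<close>)+
  have DK: "(D \<cdot> K0) \<cdot> C = K"
    by (rule ideal_prod_ext_eqI[OF AC(2) KJ(1) K0(1) cl(2) one'])
       (use K0(2) kjC in \<open>simp add: subset_iff\<close>)
  obtain I where I: "invertible_submodule A R I" "I \<cdot> D = D \<cdot> K0"
    using towers_inv_ext_surj[OF AC D invD] by blast
  have Ic: "I \<subseteq> carrier R"
    using I(1) submodule_overD(1)[OF AC(1)] by (auto simp: invertible_submodule_def)
  have "D \<cdot> C = C"
    using ideal_prod_one[OF Ds(1) submodule_over_subring[OF Ds(1) AC(2) Ds(2)]] Dc
      subringE(1)[OF AC(2)] ideal_prod_commute by simp
  then have "I \<cdot> C = K"
    using ideal_prod_assoc[OF Ic Dc subringE(1)[OF AC(2)]] I(2) DK by simp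
  then show ?thesis using I(1) by blast
qed

end

section \<open>Laurent polynomials\<close>

lemma mem_laurent_sub: "f \<in> laurent_sub R I \<longleftrightarrow> (\<forall>n. f n \<in> I) \<and> finite {n. f n \<noteq> \<zero>\<^bsub>R\<^esub>}"
  by (simp add: laurent_def)

lemma laurent_sub_carrier: "laurent_sub R (carrier R) = carrier (laurent R)"
  by (simp add: laurent_def)

lemma laurent_sub_mono: "I \<subseteq> J \<Longrightarrow> laurent_sub R I \<subseteq> laurent_sub R J"
  by (auto simp: mem_laurent_sub subset_iff)

lemma laurent_simps:
  "\<zero>\<^bsub>laurent R\<^esub> = (\<lambda>n. \<zero>\<^bsub>R\<^esub>)" "f \<oplus>\<^bsub>laurent R\<^esub> g = (\<lambda>n. f n \<oplus>\<^bsub>R\<^esub> g n)"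
  by (simp_all add: laurent_def)

definition laurent_monom :: "('a, 'b) ring_scheme \<Rightarrow> 'a \<Rightarrow> int \<Rightarrow> int \<Rightarrow> 'a" where
  "laurent_monom R a m = (\<lambda>n. if n = m then a else \<zero>\<^bsub>R\<^esub>)"

lemma laurent_const_eq_monom: "laurent_const R a = laurent_monom R a 0"
  by (simp add: laurent_const_def laurent_monom_def)

lemma one_laurent_eq_monom: "\<one>\<^bsub>laurent R\<^esub> = laurent_monom R \<one>\<^bsub>R\<^esub> 0"
  by (simp add: laurent_def laurent_monom_def)

lemma laurent_monom_mem: "a \<in> I \<Longrightarrow> \<zero>\<^bsub>R\<^esub> \<in> I \<Longrightarrow> laurent_monom R a m \<in> laurent_sub R I"
proof -
  assume *: "a \<in> I" "\<zero>\<^bsub>R\<^esub> \<in> I"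
  have "finite {n. laurent_monom R a m n \<noteq> \<zero>\<^bsub>R\<^esub>}"
    by (rule finite_subset[of _ "{m}"]) (auto simp: laurent_monom_def)
  then show ?thesis using * by (simp add: mem_laurent_sub laurent_monom_def)
qed

section \<open>Arithmetic of Laurent polynomials\<close>

context cring begin

abbreviation laurent_mult (infixl \<open>\<circledast>\<close> 70) where "f \<circledast> g \<equiv> f \<otimes>\<^bsub>laurent R\<^esub> g"
abbreviation laurent_add (infixl \<open>\<boxplus>\<close> 65) where "f \<boxplus> g \<equiv> f \<oplus>\<^bsub>laurent R\<^esub> g"

lemma laurent_add_mem:
  assumes "\<And>x y. x \<in> T \<Longrightarrow> y \<in> T \<Longrightarrow> x \<oplus> y \<in> T"
    and "f \<in> laurent_sub R T" "g \<in> laurent_sub R T"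
  shows "f \<boxplus> g \<in> laurent_sub R T"
proof -
  have "finite {n. f n \<oplus> g n \<noteq> \<zero>}"
    by (rule finite_subset[of _ "{n. f n \<noteq> \<zero>} \<union> {n. g n \<noteq> \<zero>}"])
       (use assms in \<open>auto simp: mem_laurent_sub\<close>)
  then show ?thesis using assms by (simp add: mem_laurent_sub laurent_simps)
qed

text \<open>Nonzero coefficients are removed one exponent at a time. The coefficient set
  \<open>I\<close> is arbitrary inside the ring, so that subrings, submodules and products of
  submodules can all be inserted.\<close>

lemma laurent_induct [consumes 2, case_names zero add]:
  assumes I: "I \<subseteq> carrier R" and f: "f \<in> laurent_sub R I"
    and zero: "P (\<lambda>n. \<zero>)"
    and add: "\<And>f a m. f \<in> laurent_sub R I \<Longrightarrow> a \<in> I \<Longrightarrow> \<zero> \<in> I \<Longrightarrow> P f \<Longrightarrow> P (laurent_monom R a m \<boxplus> f)"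
  shows "P f"
proof -
  \<comment> \<open>The support is finite and there are infinitely many exponents, so some
    coefficient of f is zero.\<close>
  have z: "\<zero> \<in> I"
  proof -
    have "finite {n. f n \<noteq> \<zero>}" using f by (simp add: mem_laurent_sub)
    then obtain n where "n \<notin> {n. f n \<noteq> \<zero>}" using ex_new_if_finite infinite_UNIV_int by blast
    then have "f n = \<zero>" by simp
    then show ?thesis using f by (metis mem_laurent_sub)
  qed
  have "P f" if "finite S" "{n. f n \<noteq> \<zero>} \<subseteq> S" "\<forall>n. f n \<in> I" for S f
    using that
  proof (induct arbitrary: f)
    case empty
    then have "f = (\<lambda>n. \<zero>)" by auto
    then show ?case using zero by simp
  next
    case (insert m S)
    define g where "g = f(m := \<zero>)"
    have g: "{n. g n \<noteq> \<zero>} \<subseteq> S" "\<forall>n. g n \<in> I" using insert.prems z by (auto simp: g_def)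
    have gL: "g \<in> laurent_sub R I"
      using g finite_subset[OF g(1) insert.hyps(1)] by (simp add: mem_laurent_sub)
    have "f n \<in> carrier R" for n using insert.prems(2) I by blast
    then have "f = laurent_monom R (f m) m \<boxplus> g"
      by (auto simp: fun_eq_iff g_def laurent_monom_def laurent_simps)
    moreover have "P (laurent_monom R (f m) m \<boxplus> g)"
      by (rule add) (use gL insert.prems z insert.hyps(3)[OF g] in auto)
    ultimately show ?case by simp
  qed
  then show ?thesis using f by (auto simp: mem_laurent_sub)
qed

lemma laurent_coeff: "f \<in> carrier (laurent R) \<Longrightarrow> f n \<in> carrier R"
  by (simp add: laurent_def)

text \<open>The definition sums over the exact support of f, which changes under addition. Any
  larger finite index set gives the same value, so two products can be compared over a common
  one.\<close>

lemma laurent_mult_coeff: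
  assumes S: "finite S" "{i. f i \<noteq> \<zero>} \<subseteq> S"
    and f: "\<And>n. f n \<in> carrier R" and g: "\<And>n. g n \<in> carrier R"
  shows "(f \<circledast> g) n = (\<Oplus>i\<in>S. f i \<otimes> g (n - i))"
proof -
  have "(\<Oplus>i\<in>{i. f i \<noteq> \<zero>}. f i \<otimes> g (n - i)) = (\<Oplus>i\<in>S. f i \<otimes> g (n - i))"
    by (rule add.finprod_mono_neutral_cong_left) (use assms in auto)
  then show ?thesis by (simp add: laurent_def)
qed

lemma laurent_monom_mult:
  assumes "a \<in> carrier R" "\<And>n. g n \<in> carrier R"
  shows "laurent_monom R a m \<circledast> g = (\<lambda>n. a \<otimes> g (n - m))"
proof
  fix n
  have "(laurent_monom R a m \<circledast> g) n = (\<Oplus>i\<in>{m}. laurent_monom R a m i \<otimes> g (n - i))"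
    by (rule laurent_mult_coeff) (use assms in \<open>auto simp: laurent_monom_def\<close>)
  also have "\<dots> = a \<otimes> g (n - m)" using assms by (simp add: laurent_monom_def)
  finally show "(laurent_monom R a m \<circledast> g) n = a \<otimes> g (n - m)" .
qed

lemma laurent_monom_mult_monom:
  assumes "a \<in> carrier R" "b \<in> carrier R"
  shows "laurent_monom R a m \<circledast> laurent_monom R b k = laurent_monom R (a \<otimes> b) (m + k)"
  by (subst laurent_monom_mult) (use assms in \<open>auto simp: laurent_monom_def fun_eq_iff\<close>)

lemma laurent_monom_add:
  assumes "a \<in> carrier R" "b \<in> carrier R"
  shows "laurent_monom R (a \<oplus> b) m = laurent_monom R a m \<boxplus> laurent_monom R b m"
  using assms by (auto simp: laurent_monom_def laurent_simps)

lemma laurent_zero_mult: "(\<lambda>n. \<zero>) \<circledast> g = (\<lambda>n. \<zero>)"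
  by (simp add: laurent_def)

lemma laurent_mult_zero: "f \<in> carrier (laurent R) \<Longrightarrow> f \<circledast> (\<lambda>n. \<zero>) = (\<lambda>n. \<zero>)"
  by (auto simp: laurent_def intro!: add.finprod_one_eqI)

lemma laurent_add_closed:
  "f \<in> carrier (laurent R) \<Longrightarrow> g \<in> carrier (laurent R) \<Longrightarrow> f \<boxplus> g \<in> carrier (laurent R)"
  using laurent_add_mem[of "carrier R" f g] by (simp add: laurent_sub_carrier)

lemma laurent_l_distr:
  assumes "f \<in> carrier (laurent R)" "f' \<in> carrier (laurent R)" "g \<in> carrier (laurent R)"
  shows "(f \<boxplus> f') \<circledast> g = f \<circledast> g \<boxplus> f' \<circledast> g"
proof
  note coeff = assms[THEN laurent_coeff]
  fix n
  define S where "S = {i. f i \<noteq> \<zero>} \<union> {i. f' i \<noteq> \<zero>}"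
  have S: "finite S" using assms by (simp add: S_def laurent_def)
  have "((f \<boxplus> f') \<circledast> g) n = (\<Oplus>i\<in>S. (f \<boxplus> f') i \<otimes> g (n - i))"
    by (rule laurent_mult_coeff[OF S])
       (use coeff in \<open>auto simp: S_def laurent_simps\<close>)
  also have "\<dots> = (\<Oplus>i\<in>S. f i \<otimes> g (n - i) \<oplus> f' i \<otimes> g (n - i))"
    by (rule finsum_cong') (use coeff in \<open>auto simp: laurent_simps l_distr\<close>)
  also have "\<dots> = (\<Oplus>i\<in>S. f i \<otimes> g (n - i)) \<oplus> (\<Oplus>i\<in>S. f' i \<otimes> g (n - i))"
    by (rule finsum_addf) (use coeff in auto)
  also have "(\<Oplus>i\<in>S. f i \<otimes> g (n - i)) = (f \<circledast> g) n"
    by (rule laurent_mult_coeff[OF S, symmetric]) (use coeff in \<open>auto simp: S_def\<close>)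
  also have "(\<Oplus>i\<in>S. f' i \<otimes> g (n - i)) = (f' \<circledast> g) n"
    by (rule laurent_mult_coeff[OF S, symmetric]) (use coeff in \<open>auto simp: S_def\<close>)
  finally show "((f \<boxplus> f') \<circledast> g) n = (f \<circledast> g \<boxplus> f' \<circledast> g) n" by (simp add: laurent_simps)
qed

lemma laurent_r_distr:
  assumes "f \<in> carrier (laurent R)" "g \<in> carrier (laurent R)" "g' \<in> carrier (laurent R)"
  shows "f \<circledast> (g \<boxplus> g') = f \<circledast> g \<boxplus> f \<circledast> g'"
proof
  note coeff = assms[THEN laurent_coeff]
  fix n
  define S where "S = {i. f i \<noteq> \<zero>}"
  have S: "finite S" using assms by (simp add: S_def laurent_def)
  have "(f \<circledast> (g \<boxplus> g')) n = (\<Oplus>i\<in>S. f i \<otimes> (g \<boxplus> g') (n - i))"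
    by (rule laurent_mult_coeff[OF S])
       (use coeff in \<open>auto simp: S_def laurent_simps\<close>)
  also have "\<dots> = (\<Oplus>i\<in>S. f i \<otimes> g (n - i) \<oplus> f i \<otimes> g' (n - i))"
    by (rule finsum_cong') (use coeff in \<open>auto simp: laurent_simps r_distr\<close>)
  also have "\<dots> = (\<Oplus>i\<in>S. f i \<otimes> g (n - i)) \<oplus> (\<Oplus>i\<in>S. f i \<otimes> g' (n - i))"
    by (rule finsum_addf) (use coeff in auto)
  also have "(\<Oplus>i\<in>S. f i \<otimes> g (n - i)) = (f \<circledast> g) n"
    by (rule laurent_mult_coeff[OF S, symmetric]) (use coeff in \<open>auto simp: S_def\<close>)
  also have "(\<Oplus>i\<in>S. f i \<otimes> g' (n - i)) = (f \<circledast> g') n"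
    by (rule laurent_mult_coeff[OF S, symmetric]) (use coeff in \<open>auto simp: S_def\<close>)
  finally show "(f \<circledast> (g \<boxplus> g')) n = (f \<circledast> g \<boxplus> f \<circledast> g') n" by (simp add: laurent_simps)
qed

lemma laurent_sub_closed: "I \<subseteq> carrier R \<Longrightarrow> f \<in> laurent_sub R I \<Longrightarrow> f \<in> carrier (laurent R)"
  using laurent_sub_mono[of I "carrier R" R] by (auto simp: laurent_sub_carrier)

lemma laurent_monom_closed: "a \<in> carrier R \<Longrightarrow> laurent_monom R a m \<in> carrier (laurent R)"
  using laurent_monom_mem[of a "carrier R" R] by (simp add: laurent_sub_carrier)

text \<open>Coefficients of a product are sums of products of coefficients. With three independent
  sets this serves closure of subrings, the action of scalars on modules, and products of
  modules.\<close>

lemma laurent_mult_mem: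
  assumes c: "I \<subseteq> carrier R" "J \<subseteq> carrier R"
    and IJ: "\<And>i j. i \<in> I \<Longrightarrow> j \<in> J \<Longrightarrow> i \<otimes> j \<in> T"
    and T: "\<zero> \<in> T" "\<And>x y. x \<in> T \<Longrightarrow> y \<in> T \<Longrightarrow> x \<oplus> y \<in> T"
    and f: "f \<in> laurent_sub R I" and g: "g \<in> laurent_sub R J"
  shows "f \<circledast> g \<in> laurent_sub R T"
  using c(1) f
proof (induct rule: laurent_induct)
  case zero
  then show ?case using T by (simp add: laurent_zero_mult mem_laurent_sub)
next
  case (add f a m)
  have gc: "g \<in> carrier (laurent R)" using laurent_sub_closed c g by blast
  have a: "a \<in> carrier R" using add c by blast
  have eq: "laurent_monom R a m \<circledast> g = (\<lambda>n. a \<otimes> g (n - m))"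
    by (rule laurent_monom_mult) (rule a, rule laurent_coeff[OF gc])
  have "finite {n. a \<otimes> g (n - m) \<noteq> \<zero>}"
  proof (rule finite_subset[of _ "(\<lambda>n. n + m) ` {n. g n \<noteq> \<zero>}"])
    show "{n. a \<otimes> g (n - m) \<noteq> \<zero>} \<subseteq> (\<lambda>n. n + m) ` {n. g n \<noteq> \<zero>}"
    proof
      fix n assume "n \<in> {n. a \<otimes> g (n - m) \<noteq> \<zero>}"
      then have "g (n - m) \<noteq> \<zero>" using a by auto
      then show "n \<in> (\<lambda>n. n + m) ` {n. g n \<noteq> \<zero>}" by (intro image_eqI[of _ _ "n - m"]) auto
    qed
  qed (use g in \<open>simp add: mem_laurent_sub\<close>)
  then have "laurent_monom R a m \<circledast> g \<in> laurent_sub R T"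
    using add(2) g IJ by (simp add: eq mem_laurent_sub)
  then have "laurent_monom R a m \<circledast> g \<boxplus> f \<circledast> g \<in> laurent_sub R T"
    using laurent_add_mem[OF T(2)] add by blast
  then show ?case
    using laurent_l_distr[OF laurent_monom_closed[OF a] _ gc] laurent_sub_closed[OF c(1) add(1)]
    by simp
qed

lemma laurent_mult_closed:
  "f \<in> carrier (laurent R) \<Longrightarrow> g \<in> carrier (laurent R) \<Longrightarrow> f \<circledast> g \<in> carrier (laurent R)"
  using laurent_mult_mem[of "carrier R" "carrier R" "carrier R" f g] by (simp add: laurent_sub_carrier)

lemma laurent_carrier_induct [consumes 1, case_names zero add]:
  assumes f: "f \<in> carrier (laurent R)"
    and zero: "P (\<lambda>n. \<zero>)"
    and add: "\<And>f a m. f \<in> carrier (laurent R) \<Longrightarrow> a \<in> carrier R \<Longrightarrow> P f \<Longrightarrow>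
      P (laurent_monom R a m \<boxplus> f)"
  shows "P f"
  using laurent_induct[of "carrier R" f P] assms by (simp add: laurent_sub_carrier)

lemma laurent_zero_closed: "(\<lambda>n. \<zero>) \<in> carrier (laurent R)"
  by (simp add: laurent_def)

text \<open>The defining convolution treats its factors asymmetrically; additivity in each factor
  reduces the claim to two monomials.\<close>

lemma laurent_mult_commute:
  assumes f: "f \<in> carrier (laurent R)" and g: "g \<in> carrier (laurent R)"
  shows "f \<circledast> g = g \<circledast> f"
  using f
proof (induct rule: laurent_carrier_induct)
  case zero
  then show ?case using g by (simp add: laurent_zero_mult laurent_mult_zero)
next
  case (add f a m)
  have am: "laurent_monom R a m \<in> carrier (laurent R)" using add by (intro laurent_monom_closed)
  have "laurent_monom R a m \<circledast> g = g \<circledast> laurent_monom R a m"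
    using g
  proof (induct rule: laurent_carrier_induct)
    case zero
    then show ?case using am by (simp add: laurent_zero_mult laurent_mult_zero)
  next
    case (add g b k)
    then show ?case
      using am \<open>a \<in> carrier R\<close>
      by (simp add: laurent_l_distr laurent_r_distr laurent_monom_closed laurent_monom_mult_monom
          m_comm add.commute)
  qed
  then show ?case using add g am by (simp add: laurent_l_distr laurent_r_distr)
qed

text \<open>By additivity the first two factors may be monomials; both sides then multiply h by the
  same constant and shift it by the sum of the exponents.\<close>

lemma laurent_mult_assoc:
  assumes f: "f \<in> carrier (laurent R)" and g: "g \<in> carrier (laurent R)" and h: "h \<in> carrier (laurent R)"
  shows "(f \<circledast> g) \<circledast> h = f \<circledast> (g \<circledast> h)"
  using f
proof (induct rule: laurent_carrier_induct)
  case zero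
  then show ?case by (simp add: laurent_zero_mult)
next
  case (add f a m)
  have am: "laurent_monom R a m \<in> carrier (laurent R)" using add by (intro laurent_monom_closed)
  have "laurent_monom R a m \<circledast> g \<circledast> h = laurent_monom R a m \<circledast> (g \<circledast> h)"
    using g
  proof (induct rule: laurent_carrier_induct)
    case zero
    then show ?case using am by (simp add: laurent_zero_mult laurent_mult_zero)
  next
    case (add g b k)
    have bk: "laurent_monom R b k \<in> carrier (laurent R)" using add by (intro laurent_monom_closed)
    have c: "h n \<in> carrier R" for n using h by (rule laurent_coeff)
    have "laurent_monom R a m \<circledast> laurent_monom R b k \<circledast> h = laurent_monom R a m \<circledast> (laurent_monom R b k \<circledast> h)"
      using \<open>a \<in> carrier R\<close> add c
      by (simp add: laurent_monom_mult_monom laurent_monom_mult m_assoc diff_diff_eq)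
    then show ?case
      using am bk h add by (simp add: laurent_l_distr laurent_r_distr laurent_mult_closed)
  qed
  then show ?case using add g h am by (simp add: laurent_l_distr laurent_mult_closed)
qed

lemma cring_laurent: "cring (laurent R)"
proof (rule cringI)
  show "abelian_group (laurent R)"
  proof (rule abelian_groupI)
    fix f assume f: "f \<in> carrier (laurent R)"
    have "{n. \<ominus> f n \<noteq> \<zero>} \<subseteq> {n. f n \<noteq> \<zero>}" by auto
    then have "(\<lambda>n. \<ominus> f n) \<in> carrier (laurent R)"
      using f finite_subset by (auto simp: laurent_def)
    moreover have "(\<lambda>n. \<ominus> f n) \<boxplus> f = \<zero>\<^bsub>laurent R\<^esub>"
      using laurent_coeff[OF f] by (simp add: laurent_simps l_neg)
    ultimately show "\<exists>g\<in>carrier (laurent R). g \<boxplus> f = \<zero>\<^bsub>laurent R\<^esub>" by blast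
    show "\<zero>\<^bsub>laurent R\<^esub> \<boxplus> f = f" using laurent_coeff[OF f] by (simp add: laurent_simps)
    fix g assume g: "g \<in> carrier (laurent R)"
    show "f \<boxplus> g \<in> carrier (laurent R)" using f g by (rule laurent_add_closed)
    show "f \<boxplus> g = g \<boxplus> f"
      using laurent_coeff[OF f] laurent_coeff[OF g] by (simp add: laurent_simps a_comm)
    fix h assume h: "h \<in> carrier (laurent R)"
    show "f \<boxplus> g \<boxplus> h = f \<boxplus> (g \<boxplus> h)"
      using laurent_coeff[OF f] laurent_coeff[OF g] laurent_coeff[OF h]
      by (simp add: laurent_simps a_assoc)
  qed (simp add: laurent_simps laurent_zero_closed)
  show "comm_monoid (laurent R)"
  proof (rule comm_monoidI)
    show one: "\<one>\<^bsub>laurent R\<^esub> \<in> carrier (laurent R)"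
      unfolding one_laurent_eq_monom by (rule laurent_monom_closed) simp
    show "\<one>\<^bsub>laurent R\<^esub> \<circledast> f = f" if "f \<in> carrier (laurent R)" for f
      using laurent_coeff[OF that] by (simp add: one_laurent_eq_monom laurent_monom_mult)
  qed (rule laurent_mult_closed laurent_mult_assoc laurent_mult_commute; assumption)+
qed (rule laurent_l_distr)

lemma subring_laurent_sub:
  assumes D: "subring D R"
  shows "subring (laurent_sub R D) (laurent R)"
proof -
  interpret L: cring "laurent R" by (rule cring_laurent)
  note Dc = subringE(1)[OF D]
  note cl = subringE(2,3,5,6,7)[OF D]
  have c: "f \<in> carrier (laurent R)" if "f \<in> laurent_sub R D" for f
    using laurent_sub_closed[OF Dc that] .
  show ?thesis
  proof (rule L.subringI)
    show "laurent_sub R D \<subseteq> carrier (laurent R)" using c by blast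
    show "\<one>\<^bsub>laurent R\<^esub> \<in> laurent_sub R D"
      unfolding one_laurent_eq_monom by (rule laurent_monom_mem) (use cl in auto)
    fix f assume f: "f \<in> laurent_sub R D"
    show "f \<boxplus> g \<in> laurent_sub R D" if "g \<in> laurent_sub R D" for g
      using laurent_add_mem[OF cl(5) f that] .
    show fg: "f \<circledast> g \<in> laurent_sub R D" if "g \<in> laurent_sub R D" for g
      using laurent_mult_mem[OF Dc Dc cl(4) cl(1) cl(5) f that] .
    \<comment> \<open>Negation is realised as multiplication by the constant -1, so its closure
      follows from that of products.\<close>
    have m: "laurent_monom R (\<ominus> \<one>) 0 \<in> laurent_sub R D"
      by (rule laurent_monom_mem) (use cl in auto)
    have "f \<circledast> laurent_monom R (\<ominus> \<one>) 0 = laurent_monom R (\<ominus> \<one>) 0 \<circledast> f"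
      by (rule laurent_mult_commute[OF c[OF f] c[OF m]])
    also have "\<dots> = (\<lambda>n. \<ominus> f n)"
      using laurent_coeff[OF c[OF f]] by (simp add: laurent_monom_mult l_minus)
    also have "\<dots> = \<ominus>\<^bsub>laurent R\<^esub> f"
    proof (rule L.minus_equality[symmetric])
      show "(\<lambda>n. \<ominus> f n) \<boxplus> f = \<zero>\<^bsub>laurent R\<^esub>"
        using laurent_coeff[OF c[OF f]] by (simp add: laurent_simps l_neg)
      show "(\<lambda>n. \<ominus> f n) \<in> carrier (laurent R)"
        using calculation c[OF fg[OF m]] by simp
    qed (rule c[OF f])
    finally show "\<ominus>\<^bsub>laurent R\<^esub> f \<in> laurent_sub R D" using fg[OF m] by simp
  qed
qed

section \<open>Coefficientwise extension of submodules\<close>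

lemma ideal_prod_zero:
  assumes "I \<subseteq> carrier R" "\<zero> \<in> I" "\<zero> \<in> J"
  shows "\<zero> \<in> I \<cdot> J"
  using ideal_prod.prod[OF assms(2,3), of R] by simp

text \<open>One inclusion is read off coefficients. For the other, a monomial i j X^m splits as (i
  X^m)(j), and such monomials generate additively.\<close>

lemma ideal_prod_laurent_sub:
  assumes I: "I \<subseteq> carrier R" "\<zero> \<in> I" and J: "J \<subseteq> carrier R" "\<zero> \<in> J"
  shows "ideal_prod (laurent R) (laurent_sub R I) (laurent_sub R J) = laurent_sub R (I \<cdot> J)"
proof
  interpret L: cring "laurent R" by (rule cring_laurent)
  note z = ideal_prod_zero[OF I J(2)]
  show "ideal_prod (laurent R) (laurent_sub R I) (laurent_sub R J) \<subseteq> laurent_sub R (I \<cdot> J)"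
  proof (rule L.ideal_prod_subsetI)
    fix f g assume "f \<in> laurent_sub R I" "g \<in> laurent_sub R J"
    then show "f \<circledast> g \<in> laurent_sub R (I \<cdot> J)"
      by (intro laurent_mult_mem[OF I(1) J(1)] ideal_prod.intros z)
  qed (intro laurent_add_mem ideal_prod.sum)
  show "laurent_sub R (I \<cdot> J) \<subseteq> ideal_prod (laurent R) (laurent_sub R I) (laurent_sub R J)"
  proof
    fix f assume "f \<in> laurent_sub R (I \<cdot> J)"
    with ideal_prod_closed[OF I(1) J(1)]
    show "f \<in> ideal_prod (laurent R) (laurent_sub R I) (laurent_sub R J)"
    proof (induct rule: laurent_induct)
      case zero
      have "(\<lambda>n. \<zero>) \<circledast> (\<lambda>n. \<zero>) \<in> ideal_prod (laurent R) (laurent_sub R I) (laurent_sub R J)"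
        using I J by (intro ideal_prod.prod) (auto simp: mem_laurent_sub)
      then show ?case by (simp add: laurent_zero_mult)
    next
      case (add f a m)
      have "laurent_monom R a m \<in> ideal_prod (laurent R) (laurent_sub R I) (laurent_sub R J)"
        using add(2)
      proof induct
        case (prod i j)
        then have "laurent_monom R (i \<otimes> j) m = laurent_monom R i m \<circledast> laurent_monom R j 0"
          using I J by (subst laurent_monom_mult_monom) auto
        then show ?case using prod I J by (auto intro!: ideal_prod.prod laurent_monom_mem)
      next
        case (sum s t)
        then have "laurent_monom R (s \<oplus> t) m = laurent_monom R s m \<boxplus> laurent_monom R t m"
          using ideal_prod_closed[OF I(1) J(1)] by (intro laurent_monom_add) auto
        then show ?case using sum by (auto intro: ideal_prod.sum)
      qed
      then show ?case using add(4) by (rule ideal_prod.sum)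
    qed
  qed
qed

text \<open>A monomial a X^m with a in \<open>I\<close> is the constant a times X^m, and X^m lies in
  A[X, X^-1]. This replaces the extended module by a condition on coefficients.\<close>

lemma laurent_extend_eq:
  assumes A: "subring A R" and I: "submodule_over A R I"
  shows "laurent_extend A R I = laurent_sub R I"
  unfolding laurent_extend_def
proof
  interpret L: cring "laurent R" by (rule cring_laurent)
  note I' = submodule_overD[OF A I]
  note Ac = subringE(1)[OF A]
  show "ideal_prod (laurent R) (laurent_const R ` I) (laurent_sub R A) \<subseteq> laurent_sub R I"
  proof (rule L.ideal_prod_subsetI)
    fix f g assume "f \<in> laurent_const R ` I" and g: "g \<in> laurent_sub R A"
    then have f: "f \<in> laurent_sub R I" using laurent_monom_mem I'(2) by (auto simp: laurent_const_eq_monom)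
    have "i \<otimes> a \<in> I" if "i \<in> I" "a \<in> A" for i a
    proof -
      have "i \<otimes> a = a \<otimes> i" using that I'(1) Ac by (intro m_comm) auto
      then show ?thesis using I'(4)[OF that(2,1)] by simp
    qed
    then show "f \<circledast> g \<in> laurent_sub R I"
      by (intro laurent_mult_mem[OF I'(1) Ac _ I'(2,3) f g])
  qed (intro laurent_add_mem I'(3))
  show "laurent_sub R I \<subseteq> ideal_prod (laurent R) (laurent_const R ` I) (laurent_sub R A)"
  proof
    fix f assume "f \<in> laurent_sub R I"
    with I'(1) show "f \<in> ideal_prod (laurent R) (laurent_const R ` I) (laurent_sub R A)"
    proof (induct rule: laurent_induct)
      case zero
      have "laurent_const R \<zero> \<circledast> (\<lambda>n. \<zero>) \<in> ideal_prod (laurent R) (laurent_const R ` I) (laurent_sub R A)"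
        using I'(2) subringE(2)[OF A] by (intro ideal_prod.prod) (auto simp: mem_laurent_sub)
      moreover have "laurent_const R \<zero> = (\<lambda>n. \<zero>)" by (simp add: laurent_const_def)
      ultimately show ?case by (simp add: laurent_zero_mult)
    next
      case (add f a m)
      have "laurent_monom R a m = laurent_const R a \<circledast> laurent_monom R \<one> m"
        unfolding laurent_const_eq_monom
        by (subst laurent_monom_mult_monom) (use add I' in auto)
      then have "laurent_monom R a m \<in> ideal_prod (laurent R) (laurent_const R ` I) (laurent_sub R A)"
        using add(2) subringE(2,3)[OF A] by (auto intro!: ideal_prod.prod laurent_monom_mem)
      then show ?case using add(4) by (rule ideal_prod.sum)
    qed
  qed
qed

lemma submodule_over_laurent_sub:
  assumes A: "subring A R" and I: "submodule_over A R I"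
  shows "submodule_over (laurent_sub R A) (laurent R) (laurent_sub R I)"
proof -
  interpret L: cring "laurent R" by (rule cring_laurent)
  note I' = submodule_overD[OF A I]
  show ?thesis
    unfolding L.submodule_over_iff[OF subring_laurent_sub[OF A]]
  proof (intro conjI ballI)
    show "laurent_sub R I \<subseteq> carrier (laurent R)" using laurent_sub_closed[OF I'(1)] by blast
    show "\<zero>\<^bsub>laurent R\<^esub> \<in> laurent_sub R I" using I'(2) by (simp add: mem_laurent_sub laurent_simps)
    show "f \<boxplus> g \<in> laurent_sub R I" if "f \<in> laurent_sub R I" "g \<in> laurent_sub R I" for f g
      using laurent_add_mem[OF I'(3) that] .
    show "f \<circledast> g \<in> laurent_sub R I" if "f \<in> laurent_sub R A" "g \<in> laurent_sub R I" for f g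
      using laurent_mult_mem[OF subringE(1)[OF A] I'(1) I'(4,2,3) that] .
  qed
qed

lemma invertible_submodule_laurent_sub:
  assumes A: "subring A R" and I: "invertible_submodule A R I"
  shows "invertible_submodule (laurent_sub R A) (laurent R) (laurent_sub R I)"
proof -
  obtain J where J: "submodule_over A R I" "submodule_over A R J" "I \<cdot> J = A"
    using I by (auto simp: invertible_submodule_def)
  have "ideal_prod (laurent R) (laurent_sub R I) (laurent_sub R J) = laurent_sub R A"
    using ideal_prod_laurent_sub submodule_overD(1,2)[OF A J(1)] submodule_overD(1,2)[OF A J(2)] J(3)
    by simp
  then show ?thesis
    using submodule_over_laurent_sub[OF A] J unfolding invertible_submodule_def by blast
qed

text \<open>The set \<open>I\<close> is recovered as the constants among the Laurent polynomials
  with coefficients in \<open>I\<close>.\<close>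

lemma laurent_sub_cancel:
  assumes "\<zero> \<in> I" "\<zero> \<in> J" "laurent_sub R I = laurent_sub R J"
  shows "I = J"
proof -
  have mem: "a \<in> I \<longleftrightarrow> laurent_monom R a 0 \<in> laurent_sub R I" if "\<zero> \<in> I" for I a
  proof
    assume "laurent_monom R a 0 \<in> laurent_sub R I"
    then have "laurent_monom R a 0 0 \<in> I" by (simp only: mem_laurent_sub)
    then show "a \<in> I" by (simp add: laurent_monom_def)
  next
    assume "a \<in> I"
    then show "laurent_monom R a 0 \<in> laurent_sub R I" using that by (rule laurent_monom_mem)
  qed
  have "a \<in> I \<longleftrightarrow> a \<in> J" for a
    using mem[OF assms(1), of a] mem[OF assms(2), of a] assms(3) by simp
  then show ?thesis by blast
qed

section \<open>Towers of Laurent polynomial rings\<close>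

lemma laurent_sub_adjoin:
  assumes D: "subring D R" and c: "c \<in> carrier R"
  shows "laurent_sub R (adjoin R D c) = adjoin (laurent R) (laurent_sub R D) (laurent_const R c)"
proof
  note Dc = subsetD[OF subringE(1)[OF D]]
  have mult: "b \<circledast> laurent_const R c = (\<lambda>n. b n \<otimes> c)" if b: "b \<in> laurent_sub R D" for b
  proof -
    have bc: "b \<in> carrier (laurent R)" using laurent_sub_closed[OF subringE(1)[OF D] b] .
    have "b \<circledast> laurent_const R c = laurent_monom R c 0 \<circledast> b"
      unfolding laurent_const_eq_monom by (rule laurent_mult_commute[OF bc laurent_monom_closed[OF c]])
    also have "\<dots> = (\<lambda>n. c \<otimes> b (n - 0))"
      by (rule laurent_monom_mult[OF c laurent_coeff[OF bc]])
    also have "\<dots> = (\<lambda>n. b n \<otimes> c)"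
      using m_comm[OF c laurent_coeff[OF bc]] by simp
    finally show ?thesis .
  qed
  show "laurent_sub R (adjoin R D c) \<subseteq> adjoin (laurent R) (laurent_sub R D) (laurent_const R c)"
  proof
    fix f assume f: "f \<in> laurent_sub R (adjoin R D c)"
    \<comment> \<open>The expression a + b c is not unique; choosing a = b = 0 wherever the
      coefficient of f vanishes keeps the two coefficient families finitely supported.\<close>
    have "\<forall>n. \<exists>a b. a \<in> D \<and> b \<in> D \<and> f n = a \<oplus> b \<otimes> c \<and> (f n = \<zero> \<longrightarrow> a = \<zero> \<and> b = \<zero>)"
    proof
      fix n
      show "\<exists>a b. a \<in> D \<and> b \<in> D \<and> f n = a \<oplus> b \<otimes> c \<and> (f n = \<zero> \<longrightarrow> a = \<zero> \<and> b = \<zero>)"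
      proof (cases "f n = \<zero>")
        case True
        then show ?thesis using c subringE(2)[OF D] by (intro exI[of _ \<zero>]) auto
      next
        case False
        have "f n \<in> adjoin R D c" using f by (simp add: mem_laurent_sub)
        then show ?thesis using False unfolding adjoin_def by auto
      qed
    qed
    from choice[OF this] obtain a where "\<forall>n. \<exists>b. a n \<in> D \<and> b \<in> D \<and> f n = a n \<oplus> b \<otimes> c \<and>
        (f n = \<zero> \<longrightarrow> a n = \<zero> \<and> b = \<zero>)" by fast
    from choice[OF this] obtain b where ab: "\<forall>n. a n \<in> D \<and> b n \<in> D \<and> f n = a n \<oplus> b n \<otimes> c \<and>
        (f n = \<zero> \<longrightarrow> a n = \<zero> \<and> b n = \<zero>)" by fast
    have D: "\<forall>n. a n \<in> D" "\<forall>n. b n \<in> D" using ab by blast+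
    have supp: "{n. a n \<noteq> \<zero>} \<subseteq> {n. f n \<noteq> \<zero>}" "{n. b n \<noteq> \<zero>} \<subseteq> {n. f n \<noteq> \<zero>}"
      using ab by blast+
    have fin: "finite {n. f n \<noteq> \<zero>}" using f by (simp add: mem_laurent_sub)
    have a: "a \<in> laurent_sub R D" and b: "b \<in> laurent_sub R D"
      unfolding mem_laurent_sub
      using D finite_subset[OF supp(1) fin] finite_subset[OF supp(2) fin] by blast+
    have "f = (\<lambda>n. a n \<oplus> b n \<otimes> c)" using ab by blast
    then have "f = a \<boxplus> b \<circledast> laurent_const R c" by (simp only: mult[OF b] laurent_simps)
    then show "f \<in> adjoin (laurent R) (laurent_sub R D) (laurent_const R c)"
      using a b unfolding adjoin_def by blast
  qed
  show "adjoin (laurent R) (laurent_sub R D) (laurent_const R c) \<subseteq> laurent_sub R (adjoin R D c)"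
  proof
    fix f assume "f \<in> adjoin (laurent R) (laurent_sub R D) (laurent_const R c)"
    then obtain a b where f: "f = a \<boxplus> b \<circledast> laurent_const R c"
      and a: "a \<in> laurent_sub R D" and b: "b \<in> laurent_sub R D"
      unfolding adjoin_def by blast
    have f': "f = (\<lambda>n. a n \<oplus> b n \<otimes> c)" using f by (simp only: mult[OF b] laurent_simps)
    have "{n. f n \<noteq> \<zero>} \<subseteq> {n. a n \<noteq> \<zero>} \<union> {n. b n \<noteq> \<zero>}" using c by (auto simp: fun_cong[OF f'])
    moreover have "finite ({n. a n \<noteq> \<zero>} \<union> {n. b n \<noteq> \<zero>})"
      using a b by (simp add: mem_laurent_sub)
    ultimately have "finite {n. f n \<noteq> \<zero>}" by (rule finite_subset)
    moreover have "f n \<in> adjoin R D c" for n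
      by (rule adjoinI[of _ "a n" "b n"]) (use a b in \<open>simp_all add: fun_cong[OF f'] mem_laurent_sub\<close>)
    ultimately show "f \<in> laurent_sub R (adjoin R D c)" by (simp add: mem_laurent_sub)
  qed
qed

text \<open>Each step by c becomes a step by the constant c, whose square and cube are the constants
  c^2 and c^3.\<close>

lemma towers_laurent_sub:
  assumes AC: "subring A R" "subring C R" "A \<subseteq> C" and D: "D \<in> towers R A C"
  shows "laurent_sub R D \<in> towers (laurent R) (laurent_sub R A) (laurent_sub R C)"
  using D
proof induct
  case base
  show ?case by (rule towers.base)
next
  case (step D c)
  have c: "c \<in> carrier R" using step(3) subringE(1)[OF AC(2)] by auto
  have D: "subring D R" using towers_subring[OF AC step(1)] by simp
  have m: "laurent_const R c \<circledast> laurent_const R c = laurent_const R (c \<otimes> c)"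
    "laurent_const R c \<circledast> laurent_const R (c \<otimes> c) = laurent_const R (c \<otimes> (c \<otimes> c))"
    using c by (simp_all add: laurent_const_eq_monom laurent_monom_mult_monom)
  have mem: "laurent_const R x \<in> laurent_sub R E" if "x \<in> E" "subring E R" for x E
    unfolding laurent_const_eq_monom using that(1) subringE(2)[OF that(2)] by (rule laurent_monom_mem)
  show ?case
    unfolding laurent_sub_adjoin[OF D c]
  proof (rule towers.step[OF step(2)])
    show "laurent_const R c \<in> laurent_sub R C" using step(3) AC(2) by (rule mem)
    show "laurent_const R c \<circledast> laurent_const R c \<in> laurent_sub R D"
      unfolding m using step(4) D by (rule mem)
    show "laurent_const R c \<circledast> (laurent_const R c \<circledast> laurent_const R c) \<in> laurent_sub R D"
      unfolding m using step(5) D by (rule mem)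
  qed
qed

text \<open>Finitely many Laurent polynomials have finitely many nonzero coefficients altogether,
  and a single tower ring contains these.\<close>

lemma towers_laurent_cover:
  assumes AC: "subring A R" "subring C R" "A \<subseteq> C"
    and cover: "\<And>c. c \<in> C \<Longrightarrow> \<exists>D\<in>towers R A C. c \<in> D"
    and F: "finite F" "F \<subseteq> laurent_sub R C"
  shows "\<exists>D\<in>towers (laurent R) (laurent_sub R A) (laurent_sub R C). F \<subseteq> D"
proof -
  define G where "G = (\<Union>f\<in>F. f ` {n. f n \<noteq> \<zero>})"
  have "finite G" "G \<subseteq> C" using F by (auto simp: G_def mem_laurent_sub subset_iff)
  from towers_finite[OF AC cover this] obtain D where D: "D \<in> towers R A C" "G \<subseteq> D" by fast
  have z: "\<zero> \<in> D" using towers_subring[OF AC D(1)] subringE(2)[of D R] by simp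
  have "F \<subseteq> laurent_sub R D"
  proof
    fix f assume f: "f \<in> F"
    have "f n \<in> D" for n using f D(2) z by (cases "f n = \<zero>") (simp, fastforce simp: G_def)
    then show "f \<in> laurent_sub R D" using f F(2) by (auto simp: mem_laurent_sub)
  qed
  then show ?thesis using towers_laurent_sub[OF AC D(1)] by blast
qed

end

section \<open>Exactness\<close>

lemma induced_map_coset:
  assumes G: "group G" and H: "group H" and N: "subgroup N G" and K: "subgroup K H"
    and h: "h \<in> hom G H" and hN: "h ` N \<subseteq> K" and x: "x \<in> carrier G"
  shows "induced_map H K h (N #>\<^bsub>G\<^esub> x) = K #>\<^bsub>H\<^esub> h x"
proof -
  interpret G: group G by fact
  interpret H: group H by fact
  have hx: "h x \<in> carrier H" using hom_in_carrier[OF h x] .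
  have eq: "K #>\<^bsub>H\<^esub> h y = K #>\<^bsub>H\<^esub> h x" if y: "y \<in> N #>\<^bsub>G\<^esub> x" for y
  proof -
    obtain n where n: "n \<in> N" "y = n \<otimes>\<^bsub>G\<^esub> x" using y unfolding r_coset_def by blast
    have nG: "n \<in> carrier G" using n(1) subgroup.subset[OF N] by blast
    have hn: "h n \<in> K" using hN n(1) by blast
    have hnH: "h n \<in> carrier H" using hn subgroup.subset[OF K] by blast
    have "h y = h n \<otimes>\<^bsub>H\<^esub> h x" using hom_mult[OF h nG x] n(2) by simp
    then have "K #>\<^bsub>H\<^esub> h y = (K #>\<^bsub>H\<^esub> h n) #>\<^bsub>H\<^esub> h x"
      using H.coset_mult_assoc[OF subgroup.subset[OF K] hnH hx] by simp
    then show ?thesis using H.coset_join2[OF hnH K hn] by simp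
  qed
  \<comment> \<open>The map is constant on the coset, and the coset is nonempty, so the image is the
    singleton that \<open>the_elem\<close> requires.\<close>
  have "(\<lambda>y. K #>\<^bsub>H\<^esub> h y) ` (N #>\<^bsub>G\<^esub> x) = (\<lambda>_. K #>\<^bsub>H\<^esub> h x) ` (N #>\<^bsub>G\<^esub> x)"
    by (rule image_cong[OF refl eq])
  also have "\<dots> = {K #>\<^bsub>H\<^esub> h x}" by (rule image_constant[OF G.rcos_self[OF x N]])
  finally have "(\<lambda>y. K #>\<^bsub>H\<^esub> h y) ` (N #>\<^bsub>G\<^esub> x) = {K #>\<^bsub>H\<^esub> h x}" .
  then show ?thesis unfolding induced_map_def by simp
qed

lemma induced_map_hom:
  assumes G: "group G" and H: "group H" and N: "N \<lhd> G" and K: "K \<lhd> H"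
    and h: "h \<in> hom G H" and hN: "h ` N \<subseteq> K"
  shows "induced_map H K h \<in> hom (G Mod N) (H Mod K)"
proof -
  interpret G: group G by fact
  interpret H: group H by fact
  interpret N: normal N G by fact
  interpret K: normal K H by fact
  note ind = induced_map_coset[OF G H N.subgroup_axioms K.subgroup_axioms h hN]
  show ?thesis
  proof (rule homI)
    fix S assume "S \<in> carrier (G Mod N)"
    then obtain x where x: "x \<in> carrier G" "S = N #>\<^bsub>G\<^esub> x"
      by (auto simp: FactGroup_def RCOSETS_def)
    show "induced_map H K h S \<in> carrier (H Mod K)"
      unfolding x(2) ind[OF x(1)] using H.rcosetsI[OF K.subset hom_in_carrier[OF h x(1)]]
      by (simp add: FactGroup_def)
    fix T assume "T \<in> carrier (G Mod N)"
    then obtain y where y: "y \<in> carrier G" "T = N #>\<^bsub>G\<^esub> y"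
      by (auto simp: FactGroup_def RCOSETS_def)
    have "S \<otimes>\<^bsub>G Mod N\<^esub> T = N #>\<^bsub>G\<^esub> (x \<otimes>\<^bsub>G\<^esub> y)"
      using N.rcos_sum[OF x(1) y(1)] x(2) y(2) by (simp add: FactGroup_def)
    then show "induced_map H K h (S \<otimes>\<^bsub>G Mod N\<^esub> T) =
        induced_map H K h S \<otimes>\<^bsub>H Mod K\<^esub> induced_map H K h T"
      using K.rcos_sum[OF hom_in_carrier[OF h x(1)] hom_in_carrier[OF h y(1)]]
      by (simp add: ind x y hom_mult[OF h] FactGroup_def)
  qed
qed

text \<open>The passage to quotients in the nine lemma. \<open>N12\<close> gives injectivity on the
  left, \<open>N23\<close> gives exactness in the middle, and \<open>surj\<close> gives the right
  end. The lists of \<open>exact_seq\<close> run from the last group back to the first.\<close>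

lemma exact_seq_Mod:
  fixes G1 G2 :: "'a monoid" and G3 :: "'a monoid"
  assumes G: "comm_group G1" "comm_group G2" "comm_group G3"
    and N: "subgroup N1 G1" "subgroup N2 G2" "subgroup N3 G3"
    and incl: "(\<lambda>x. x) \<in> hom G1 G2" and h: "h \<in> hom G2 G3"
    and ker: "carrier G1 = {x \<in> carrier G2. h x = \<one>\<^bsub>G3\<^esub>}"
    and surj: "h ` carrier G2 = carrier G3"
    and N12: "N1 = N2 \<inter> carrier G1" and N23: "h ` N2 = N3"
  shows "exact_seq
    ([singleton_group \<one>\<^bsub>G3 Mod N3\<^esub>, G3 Mod N3, G2 Mod N2, G1 Mod N1, singleton_group \<one>\<^bsub>G1 Mod N1\<^esub>],
     [\<lambda>_. \<one>\<^bsub>G3 Mod N3\<^esub>, induced_map G3 N3 h, induced_map G2 N2 (\<lambda>x. x), \<lambda>_. \<one>\<^bsub>G1 Mod N1\<^esub>])"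
proof -
  interpret G1: comm_group G1 by fact
  interpret G2: comm_group G2 by fact
  interpret G3: comm_group G3 by fact
  interpret N1: normal N1 G1 using N(1) by (rule G1.subgroup_imp_normal)
  interpret N2: normal N2 G2 using N(2) by (rule G2.subgroup_imp_normal)
  interpret N3: normal N3 G3 using N(3) by (rule G3.subgroup_imp_normal)
  interpret h: group_hom G2 G3 h by unfold_locales (rule h)
  interpret Q1: group "G1 Mod N1" by (rule N1.factorgroup_is_group)
  interpret Q2: group "G2 Mod N2" by (rule N2.factorgroup_is_group)
  interpret Q3: group "G3 Mod N3" by (rule N3.factorgroup_is_group)
  have N12': "(\<lambda>x. x) ` N1 \<subseteq> N2" and N23': "h ` N2 \<subseteq> N3" using N12 N23 by auto
  define i where "i = induced_map G2 N2 (\<lambda>x. x)"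
  define p where "p = induced_map G3 N3 h"
  have ihom: "i \<in> hom (G1 Mod N1) (G2 Mod N2)"
    unfolding i_def by (rule induced_map_hom[OF G1.is_group G2.is_group N1.normal_axioms N2.normal_axioms incl N12'])
  have phom: "p \<in> hom (G2 Mod N2) (G3 Mod N3)"
    unfolding p_def by (rule induced_map_hom[OF G2.is_group G3.is_group N2.normal_axioms N3.normal_axioms h N23'])
  have i: "i (N1 #>\<^bsub>G1\<^esub> x) = N2 #>\<^bsub>G2\<^esub> x" if "x \<in> carrier G1" for x
    unfolding i_def by (rule induced_map_coset[OF G1.is_group G2.is_group N(1,2) incl N12' that])
  have p: "p (N2 #>\<^bsub>G2\<^esub> x) = N3 #>\<^bsub>G3\<^esub> h x" if "x \<in> carrier G2" for x
    unfolding p_def by (rule induced_map_coset[OF G2.is_group G3.is_group N(2,3) h N23' that])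
  have car: "carrier (G1 Mod N1) = (\<lambda>x. N1 #>\<^bsub>G1\<^esub> x) ` carrier G1"
    "carrier (G2 Mod N2) = (\<lambda>x. N2 #>\<^bsub>G2\<^esub> x) ` carrier G2"
    "carrier (G3 Mod N3) = (\<lambda>x. N3 #>\<^bsub>G3\<^esub> x) ` carrier G3"
    by (auto simp: FactGroup_def RCOSETS_def)
  have one: "\<one>\<^bsub>G1 Mod N1\<^esub> = N1" "\<one>\<^bsub>G2 Mod N2\<^esub> = N2" "\<one>\<^bsub>G3 Mod N3\<^esub> = N3"
    by (simp_all add: FactGroup_def)
  have sub12: "carrier G1 \<subseteq> carrier G2" using ker by blast
  have ker_i: "kernel (G1 Mod N1) (G2 Mod N2) i = {N1}"
  proof
    show "{N1} \<subseteq> kernel (G1 Mod N1) (G2 Mod N2) i"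
      using hom_one[OF ihom Q1.is_group Q2.is_group] Q1.one_closed one by (simp add: kernel_def)
    show "kernel (G1 Mod N1) (G2 Mod N2) i \<subseteq> {N1}"
    proof
      fix S assume "S \<in> kernel (G1 Mod N1) (G2 Mod N2) i"
      then obtain x where x: "x \<in> carrier G1" "S = N1 #>\<^bsub>G1\<^esub> x" "i S = N2"
        unfolding kernel_def car one by blast
      then have "N2 #>\<^bsub>G2\<^esub> x = N2" using i by simp
      then have "x \<in> N2" using G2.coset_join1[OF _ _ N(2)] x(1) sub12 by blast
      then have "x \<in> N1" using N12 x(1) by blast
      then show "S \<in> {N1}" using G1.coset_join2[OF x(1) N(1)] x(2) by simp
    qed
  qed
  have ker_p: "kernel (G2 Mod N2) (G3 Mod N3) p = i ` carrier (G1 Mod N1)"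
  proof
    show "i ` carrier (G1 Mod N1) \<subseteq> kernel (G2 Mod N2) (G3 Mod N3) p"
    proof
      fix S assume "S \<in> i ` carrier (G1 Mod N1)"
      then obtain x where x: "x \<in> carrier G1" "S = N2 #>\<^bsub>G2\<^esub> x" unfolding car using i by auto
      then have x2: "x \<in> carrier G2" and hx: "h x = \<one>\<^bsub>G3\<^esub>" using ker by auto
      have "p S = N3" using p[OF x2] x(2) hx G3.coset_join2[OF _ N(3) N3.one_closed] by simp
      then show "S \<in> kernel (G2 Mod N2) (G3 Mod N3) p"
        using x(2) x2 by (simp add: kernel_def car one)
    qed
    show "kernel (G2 Mod N2) (G3 Mod N3) p \<subseteq> i ` carrier (G1 Mod N1)"
    proof
      fix S assume "S \<in> kernel (G2 Mod N2) (G3 Mod N3) p"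
      then obtain x where x: "x \<in> carrier G2" "S = N2 #>\<^bsub>G2\<^esub> x" "p S = N3"
        unfolding kernel_def car one by blast
      then have "N3 #>\<^bsub>G3\<^esub> h x = N3" using p by simp
      then have "h x \<in> N3" using G3.coset_join1[OF _ h.hom_closed[OF x(1)] N(3)] by blast
      \<comment> \<open>The lift n of \<open>h x\<close> into \<open>N2\<close> is divided out of x:
        this leaves the coset of x unchanged and moves x into the kernel of h, which is
        \<open>G1\<close>.\<close>
      then obtain n where n: "n \<in> N2" "h x = h n" using N23 by blast
      have nG: "n \<in> carrier G2" using n(1) N2.subset by blast
      define y where "y = inv\<^bsub>G2\<^esub> n \<otimes>\<^bsub>G2\<^esub> x"
      have y2: "y \<in> carrier G2" using nG x(1) by (simp add: y_def)
      have "h y = \<one>\<^bsub>G3\<^esub>" using nG x(1) n(2) by (simp add: y_def)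
      then have y1: "y \<in> carrier G1" using ker y2 by blast
      have "S = (N2 #>\<^bsub>G2\<^esub> inv\<^bsub>G2\<^esub> n) #>\<^bsub>G2\<^esub> x"
        using G2.coset_join2[OF _ N(2), of "inv\<^bsub>G2\<^esub> n"] n(1) nG x(2) by simp
      also have "\<dots> = N2 #>\<^bsub>G2\<^esub> y"
        unfolding y_def using nG x(1) N2.subset by (intro G2.coset_mult_assoc) auto
      finally show "S \<in> i ` carrier (G1 Mod N1)" using y1 i[OF y1] car(1) by auto
    qed
  qed
  have surj_p: "p ` carrier (G2 Mod N2) = carrier (G3 Mod N3)"
    unfolding car surj[symmetric] image_image using p by (intro image_cong) auto
  define t1 where "t1 = (\<lambda>_ :: 'a set. \<one>\<^bsub>G1 Mod N1\<^esub>)"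
  define t3 where "t3 = (\<lambda>_ :: 'a set. \<one>\<^bsub>G3 Mod N3\<^esub>)"
  define S1 where "S1 = singleton_group \<one>\<^bsub>G1 Mod N1\<^esub>"
  define S3 where "S3 = singleton_group \<one>\<^bsub>G3 Mod N3\<^esub>"
  have S: "group S1" "group S3" by (simp_all add: S1_def S3_def)
  have t1: "t1 \<in> hom S1 (G1 Mod N1)"
    using Q1.one_closed Q1.l_one[OF Q1.one_closed] by (intro homI) (auto simp: t1_def)
  have t3: "t3 \<in> hom (G3 Mod N3) S3" by (simp add: S3_def t3_def)
  have 1: "exact_seq ([G1 Mod N1, S1], [t1])"
    by (rule exact_seq.unity) (intro group_hom.intro group_hom_axioms.intro S Q1.is_group t1)
  have "kernel (G1 Mod N1) (G2 Mod N2) i = t1 ` carrier S1"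
    using ker_i by (simp add: t1_def S1_def one)
  from exact_seq.extension[OF 1 Q2.is_group ihom this]
  have 2: "exact_seq ([G2 Mod N2, G1 Mod N1, S1], [i, t1])" .
  have 3: "exact_seq ([G3 Mod N3, G2 Mod N2, G1 Mod N1, S1], [p, i, t1])"
    by (rule exact_seq.extension[OF 2 Q3.is_group phom ker_p])
  have "kernel (G3 Mod N3) S3 t3 = p ` carrier (G2 Mod N2)"
    unfolding surj_p by (auto simp: kernel_def t3_def S3_def singleton_group_def)
  from exact_seq.extension[OF 3 S(2) t3 this]
  have "exact_seq ([S3, G3 Mod N3, G2 Mod N2, G1 Mod N1, S1], [t3, p, i, t1])" .
  then show ?thesis unfolding i_def p_def t1_def t3_def S1_def S3_def .
qed

section \<open>Extension of scalars for invertible submodules\<close>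

context cring begin

lemma inv_groupD:
  assumes A: "subring A R" and I: "I \<in> carrier (inv_group A R)"
  shows "submodule_over A R I" "I \<subseteq> carrier R" "\<zero> \<in> I"
    "\<exists>J. submodule_over A R J \<and> J \<subseteq> carrier R \<and> \<zero> \<in> J \<and> I \<cdot> J = A"
proof -
  obtain J where J: "submodule_over A R I" "submodule_over A R J" "I \<cdot> J = A"
    using I by (auto simp: inv_group_def invertible_submodule_def)
  then show "submodule_over A R I" "I \<subseteq> carrier R" "\<zero> \<in> I"
    "\<exists>J. submodule_over A R J \<and> J \<subseteq> carrier R \<and> \<zero> \<in> J \<and> I \<cdot> J = A"
    using submodule_overD(1,2)[OF A J(1)] submodule_overD(1,2)[OF A J(2)] by auto
qed

lemma subring_prod_eq:
  assumes "subring A R" "subring C R" "A \<subseteq> C"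
  shows "A \<cdot> C = C" "C \<cdot> C = C"
proof -
  have "C \<cdot> A = C" by (rule ideal_prod_one[OF assms(1) submodule_over_subring[OF assms]])
  then show "A \<cdot> C = C"
    using ideal_prod_commute[OF subringE(1)[OF assms(1)] subringE(1)[OF assms(2)]] by simp
  show "C \<cdot> C = C" by (rule ideal_prod_one[OF assms(2) submodule_over_subring[OF assms(2,2) subset_refl]])
qed

lemma submodule_over_ext:
  assumes C: "subring C R" and I: "I \<subseteq> carrier R" "\<zero> \<in> I"
  shows "submodule_over C R (I \<cdot> C)"
proof -
  have "submodule_over C R (C \<cdot> I)"
    using I by (intro submodule_over_ideal_prod[OF C submodule_over_subring[OF C C subset_refl]]) auto
  then show ?thesis using ideal_prod_commute[OF I(1) subringE(1)[OF C]] by simp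
qed

lemma ext_prod:
  assumes AC: "subring A R" "subring C R" "A \<subseteq> C" and I: "I \<subseteq> carrier R" and J: "J \<subseteq> carrier R"
  shows "(I \<cdot> C) \<cdot> (J \<cdot> C) = (I \<cdot> J) \<cdot> C"
proof -
  note Cc = subringE(1)[OF AC(2)]
  note JC = ideal_prod_closed[OF J Cc]
  have "(I \<cdot> C) \<cdot> (J \<cdot> C) = I \<cdot> (C \<cdot> (J \<cdot> C))" by (rule ideal_prod_assoc[OF I Cc JC])
  also have "C \<cdot> (J \<cdot> C) = (J \<cdot> C) \<cdot> C" by (rule ideal_prod_commute[OF Cc JC])
  also have "\<dots> = J \<cdot> C" using ideal_prod_assoc[OF J Cc Cc] subring_prod_eq(2)[OF AC] by simp
  also have "I \<cdot> (J \<cdot> C) = (I \<cdot> J) \<cdot> C" by (rule ideal_prod_assoc[OF I J Cc, symmetric])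
  finally show ?thesis .
qed

lemma inv_ext_hom:
  assumes AC: "subring A R" "subring C R" "A \<subseteq> C"
  shows "(\<lambda>I. I \<cdot> C) \<in> hom (inv_group A R) (inv_group C R)"
proof (rule homI)
  fix I assume I: "I \<in> carrier (inv_group A R)"
  note I' = inv_groupD[OF AC(1) I]
  then obtain J where J: "submodule_over A R J" "J \<subseteq> carrier R" "\<zero> \<in> J" "I \<cdot> J = A" by blast
  have "(I \<cdot> C) \<cdot> (J \<cdot> C) = C"
    unfolding ext_prod[OF AC I'(2) J(2)] J(4) by (rule subring_prod_eq(1)[OF AC])
  then show "I \<cdot> C \<in> carrier (inv_group C R)"
    using submodule_over_ext[OF AC(2) I'(2,3)] submodule_over_ext[OF AC(2) J(2,3)]
    by (auto simp: inv_group_def invertible_submodule_def)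
  fix K assume K: "K \<in> carrier (inv_group A R)"
  show "(I \<otimes>\<^bsub>inv_group A R\<^esub> K) \<cdot> C = (I \<cdot> C) \<otimes>\<^bsub>inv_group C R\<^esub> (K \<cdot> C)"
    using ext_prod[OF AC I'(2) inv_groupD(2)[OF AC(1) K]] by (simp add: inv_group_def)
qed

text \<open>The right side describes I(A, C) inside the ambient ring. From
  \<open>I \<cdot> C = C\<close> one gets J C = J (I C) = (J I) C = C for the inverse
  \<open>J\<close>, and a module S with S C = C lies in \<open>C\<close> because 1 does. The
  converse is the dual basis argument with \<open>K = C\<close>.\<close>

lemma inv_ext_trivial_iff:
  assumes AC: "subring A R" "subring C R" "A \<subseteq> C"
  shows "I \<in> carrier (inv_group A R) \<and> I \<cdot> C = C \<longleftrightarrow>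
    submodule_over A R I \<and> I \<subseteq> C \<and> (\<exists>J. submodule_over A R J \<and> J \<subseteq> C \<and> I \<cdot> J = A)"
    (is "?l \<longleftrightarrow> ?r")
proof
  note Cc = subringE(1)[OF AC(2)]
  have sub: "S \<subseteq> C" if S: "S \<subseteq> carrier R" "S \<cdot> C = C" for S
  proof
    fix s assume s: "s \<in> S"
    then have "s \<otimes> \<one> \<in> S \<cdot> C" using subringE(3)[OF AC(2)] by (rule ideal_prod.prod)
    then show "s \<in> C" using s S by auto
  qed
  assume l: ?l
  then have I: "I \<in> carrier (inv_group A R)" "I \<cdot> C = C" by auto
  note I' = inv_groupD[OF AC(1) I(1)]
  then obtain J where J: "submodule_over A R J" "J \<subseteq> carrier R" "\<zero> \<in> J" "I \<cdot> J = A" by blast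
  have "J \<cdot> C = J \<cdot> (I \<cdot> C)" using I(2) by simp
  also have "\<dots> = (J \<cdot> I) \<cdot> C" by (rule ideal_prod_assoc[OF J(2) I'(2) Cc, symmetric])
  also have "J \<cdot> I = A" using J(4) ideal_prod_commute[OF J(2) I'(2)] by simp
  finally have "J \<cdot> C = C" using subring_prod_eq(1)[OF AC] by simp
  then have "J \<subseteq> C" using sub J(2) by simp
  moreover have "I \<subseteq> C" using sub I'(2) I(2) by simp
  ultimately show ?r using I'(1) J(1,4) by blast
next
  assume ?r
  then obtain J where I: "submodule_over A R I" "I \<subseteq> C" and J: "submodule_over A R J" "J \<subseteq> C" "I \<cdot> J = A"
    by blast
  note Cc = subringE(1)[OF AC(2)]
  have "I \<cdot> C = C"
  proof (rule ideal_prod_ext_eqI[OF AC(2) submodule_over_subring[OF AC(2,2) subset_refl] I(2)])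
    show "J \<subseteq> carrier R" using J(2) Cc by (rule subset_trans)
    show "\<one> \<in> I \<cdot> J" using J(3) subringE(3)[OF AC(1)] by simp
    show "x \<otimes> y \<in> C" if "x \<in> C" "y \<in> J" for x y
      using that(1) subsetD[OF J(2) that(2)] by (rule subringE(6)[OF AC(2)])
  qed
  moreover have "I \<in> carrier (inv_group A R)"
    using I(1) J(1,3) by (auto simp: inv_group_def invertible_submodule_def)
  ultimately show ?l by blast
qed

text \<open>The ring \<open>S\<close> is \<open>C\<close> with its own, possibly different, operations outside of \<open>C\<close>.\<close>

lemma inv_group_restrict:
  fixes S :: "('a, 'c) ring_scheme"
  assumes S: "cring S" "carrier S = C" "\<zero>\<^bsub>S\<^esub> = \<zero>" "add S = add R"
    and mult: "\<And>x y. x \<in> C \<Longrightarrow> y \<in> C \<Longrightarrow> x \<otimes>\<^bsub>S\<^esub> y = x \<otimes> y"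
    and AC: "subring A R" "subring A S" "subring C R" "A \<subseteq> C"
  shows "I \<subseteq> C \<Longrightarrow> J \<subseteq> C \<Longrightarrow> ideal_prod S I J = I \<cdot> J"
    and "submodule_over A S I \<longleftrightarrow> submodule_over A R I \<and> I \<subseteq> C"
    and "carrier (inv_group A S) = {I \<in> carrier (inv_group A R). I \<cdot> C = C}"
proof -
  show prod: "ideal_prod S I J = I \<cdot> J" if IJ: "I \<subseteq> C" "J \<subseteq> C" for I J
  proof (intro equalityI subsetI)
    fix x assume "x \<in> ideal_prod S I J"
    then show "x \<in> I \<cdot> J"
    proof induct
      case (prod i j)
      then have "i \<otimes>\<^bsub>S\<^esub> j = i \<otimes> j" using IJ by (intro mult) auto
      then show ?case using ideal_prod.prod[OF prod, of R] by simp
    next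
      case (sum s t)
      then show ?case using ideal_prod.sum[of s R I J t] by (simp add: S(4))
    qed
  next
    fix x assume "x \<in> I \<cdot> J"
    then show "x \<in> ideal_prod S I J"
    proof induct
      case (prod i j)
      then have "i \<otimes>\<^bsub>S\<^esub> j = i \<otimes> j" using IJ by (intro mult) auto
      then show ?case using ideal_prod.prod[OF prod, of S] by simp
    next
      case (sum s t)
      then show ?case using ideal_prod.sum[of s S I J t] by (simp add: S(4))
    qed
  qed
  have subC: "C \<subseteq> carrier R" by (rule subringE(1)[OF AC(3)])
  show subm: "submodule_over A S I \<longleftrightarrow> submodule_over A R I \<and> I \<subseteq> C" for I
  proof -
    have iff: "submodule_over A S I \<longleftrightarrow> I \<subseteq> C \<and> \<zero> \<in> I \<and>
        (\<forall>x\<in>I. \<forall>y\<in>I. x \<oplus> y \<in> I) \<and> (\<forall>a\<in>A. \<forall>x\<in>I. a \<otimes>\<^bsub>S\<^esub> x \<in> I)"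
      using cring.submodule_over_iff[OF S(1) AC(2)] by (simp only: S(2-4))
    show ?thesis
    proof (cases "I \<subseteq> C")
      case True
      have "(\<forall>a\<in>A. \<forall>x\<in>I. a \<otimes>\<^bsub>S\<^esub> x \<in> I) \<longleftrightarrow> (\<forall>a\<in>A. \<forall>x\<in>I. a \<otimes> x \<in> I)"
        using True AC(4) by (intro ball_cong refl, subst mult) auto
      then show ?thesis
        using iff submodule_over_iff[OF AC(1)] True subset_trans[OF True subC] by simp
    qed (simp add: iff)
  qed
  show "carrier (inv_group A S) = {I \<in> carrier (inv_group A R). I \<cdot> C = C}"
  proof (rule Set.set_eqI)
    fix I
    have "I \<in> carrier (inv_group A S) \<longleftrightarrow>
        submodule_over A R I \<and> I \<subseteq> C \<and> (\<exists>J. submodule_over A R J \<and> J \<subseteq> C \<and> ideal_prod S I J = A)"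
      by (simp add: inv_group_def invertible_submodule_def subm)
    also have "\<dots> \<longleftrightarrow>
        submodule_over A R I \<and> I \<subseteq> C \<and> (\<exists>J. submodule_over A R J \<and> J \<subseteq> C \<and> I \<cdot> J = A)"
      by (intro conj_cong refl ex_cong1) (simp add: prod)
    also have "\<dots> \<longleftrightarrow> I \<in> {I \<in> carrier (inv_group A R). I \<cdot> C = C}"
      using inv_ext_trivial_iff[OF AC(1,3,4), of I] by simp
    finally show "I \<in> carrier (inv_group A S) \<longleftrightarrow> I \<in> {I \<in> carrier (inv_group A R). I \<cdot> C = C}" .
  qed
qed

section \<open>The subring \<open>C\<close> as a ring in its own right\<close>

lemma cring_subring: "subring C R \<Longrightarrow> cring (R\<lparr>carrier := C\<rparr>)"
  using subcring_iff[OF subringE(1)[of C R]] subcringI'[of C] by simp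

text \<open>The carrier enters the definition of \<open>finsum\<close>, so the sums in
  \<open>C\<close> and in the ambient ring are different terms. They agree for values in
  \<open>C\<close>, which is why Laurent products over \<open>C\<close> and over the ambient ring
  are compared only for coefficients in \<open>C\<close>.\<close>

lemma finsum_restrict:
  assumes C: "subring C R" and Y: "finite Y" "\<And>i. i \<in> Y \<Longrightarrow> f i \<in> C"
  shows "finsum (R\<lparr>carrier := C\<rparr>) f Y = finsum R f Y"
proof -
  interpret S: cring "R\<lparr>carrier := C\<rparr>" by (rule cring_subring[OF C])
  show ?thesis
    using Y
  proof induct
    case empty
    show ?case using S.finsum_empty[of f] finsum_empty[of f] by simp
  next
    case (insert i Y)
    have c: "f i \<in> C" "f \<in> Y \<rightarrow> C" using insert by auto
    have c': "f i \<in> carrier R" "f \<in> Y \<rightarrow> carrier R" using c subringE(1)[OF C] by auto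
    have "finsum (R\<lparr>carrier := C\<rparr>) f (insert i Y) = f i \<oplus> finsum (R\<lparr>carrier := C\<rparr>) f Y"
      using S.finsum_insert[OF insert(1,2), of f] c by simp
    moreover have "finsum R f (insert i Y) = f i \<oplus> finsum R f Y"
      using finsum_insert[OF insert(1,2), of f] c' by simp
    ultimately show ?case using insert by simp
  qed
qed

lemma laurent_mult_restrict:
  assumes C: "subring C R" and f: "f \<in> laurent_sub R C" and g: "g \<in> laurent_sub R C"
  shows "f \<otimes>\<^bsub>laurent (R\<lparr>carrier := C\<rparr>)\<^esub> g = f \<circledast> g"
proof
  fix n
  have fin: "finite {i. f i \<noteq> \<zero>}" using f by (simp add: mem_laurent_sub)
  have "f i \<otimes> g (n - i) \<in> C" for i
    using f g by (intro subringE(6)[OF C]) (simp_all add: mem_laurent_sub)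
  from finsum_restrict[OF C fin this]
  show "(f \<otimes>\<^bsub>laurent (R\<lparr>carrier := C\<rparr>)\<^esub> g) n = (f \<circledast> g) n"
    by (simp add: laurent_def)
qed

lemma subring_restrict:
  assumes "subring A R" "subring C R" "A \<subseteq> C"
  shows "subring A (R\<lparr>carrier := C\<rparr>)"
proof -
  interpret S: cring "R\<lparr>carrier := C\<rparr>" by (rule cring_subring[OF assms(2)])
  show ?thesis
    by (rule S.ring_incl_imp_subring) (use assms subring_is_ring[OF assms(1)] in simp_all)
qed

lemma laurent_image_eq:
  assumes "subring A R"
  shows "laurent_image A R = laurent_sub R ` carrier (inv_group A R)"
  unfolding laurent_image_def
  by (rule image_cong[OF refl laurent_extend_eq[OF assms inv_groupD(1)[OF assms]]])

lemma comm_group_laurent_inv_group: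
  assumes "subring A R"
  shows "comm_group (laurent_inv_group A R)"
  unfolding laurent_inv_group_def
  by (rule cring.comm_group_inv_group[OF cring_laurent subring_laurent_sub[OF assms]])

lemma subgroup_laurent_image:
  assumes A: "subring A R"
  shows "subgroup (laurent_image A R) (laurent_inv_group A R)"
proof -
  interpret G: comm_group "inv_group A R" by (rule comm_group_inv_group[OF A])
  interpret H: comm_group "laurent_inv_group A R" by (rule comm_group_laurent_inv_group[OF A])
  have "laurent_sub R \<in> hom (inv_group A R) (laurent_inv_group A R)"
  proof (rule homI)
    fix I assume I: "I \<in> carrier (inv_group A R)"
    then show "laurent_sub R I \<in> carrier (laurent_inv_group A R)"
      using invertible_submodule_laurent_sub[OF A] by (simp add: laurent_inv_group_def inv_group_def)
    fix J assume J: "J \<in> carrier (inv_group A R)"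
    show "laurent_sub R (I \<otimes>\<^bsub>inv_group A R\<^esub> J) =
        laurent_sub R I \<otimes>\<^bsub>laurent_inv_group A R\<^esub> laurent_sub R J"
      using ideal_prod_laurent_sub[OF inv_groupD(2,3)[OF A I] inv_groupD(2,3)[OF A J]]
      by (simp add: laurent_inv_group_def inv_group_def)
  qed
  then interpret group_hom "inv_group A R" "laurent_inv_group A R" "laurent_sub R"
    by unfold_locales
  show ?thesis unfolding laurent_image_eq[OF A] by (rule img_is_subgroup)
qed

end

theorem proposition3p3:
  fixes B :: "('a, 'b) ring_scheme" and A C :: "'a set"
  assumes "cring B" and "subring A B" and "subring C B" and "A \<subseteq> C"
    and "subintegral B A C"
  shows "exact_seq
    ([singleton_group \<one>\<^bsub>MI C B\<^esub>, MI C B, MI A B, MI A (B\<lparr>carrier := C\<rparr>),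
      singleton_group \<one>\<^bsub>MI A (B\<lparr>carrier := C\<rparr>)\<^esub>],
     [\<lambda>_. \<one>\<^bsub>MI C B\<^esub>, MI_ext C B, MI_incl A B, \<lambda>_. \<one>\<^bsub>MI A (B\<lparr>carrier := C\<rparr>)\<^esub>])"
proof -
  interpret B: cring B by fact
  let ?S = "B\<lparr>carrier := C\<rparr>"
  let ?L = "laurent_sub B"
  note AC = assms(2-4)
  interpret S: cring ?S by (rule B.cring_subring[OF AC(2)])
  interpret LB: cring "laurent B" by (rule B.cring_laurent)
  have AS: "subring A ?S" by (rule B.subring_restrict[OF AC])
  have LAC: "subring (?L A) (laurent B)" "subring (?L C) (laurent B)" "?L A \<subseteq> ?L C"
    by (rule B.subring_laurent_sub[OF AC(1)] B.subring_laurent_sub[OF AC(2)] laurent_sub_mono[OF AC(3)])+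
  have LAS: "subring (?L A) (laurent ?S)"
    using S.subring_laurent_sub[OF AS] by simp
  have LScar: "carrier (laurent ?S) = ?L C" by (simp add: laurent_def)
  have LSzero: "\<zero>\<^bsub>laurent ?S\<^esub> = \<zero>\<^bsub>laurent B\<^esub>" by (simp add: laurent_def)
  have LSadd: "add (laurent ?S) = add (laurent B)" by (simp add: laurent_def)
  have Lmult: "\<And>f g. f \<in> ?L C \<Longrightarrow> g \<in> ?L C \<Longrightarrow> f \<otimes>\<^bsub>laurent ?S\<^esub> g = f \<otimes>\<^bsub>laurent B\<^esub> g"
    by (rule B.laurent_mult_restrict[OF AC(2)])
  note LS = S.cring_laurent LScar LSzero LSadd
  have Lprod: "ideal_prod (laurent ?S) I J = ideal_prod (laurent B) I J"
    if "I \<subseteq> ?L C" "J \<subseteq> ?L C" for I J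
    by (rule LB.inv_group_restrict(1)[OF LS _ LAC(1) LAS LAC(2,3) that]) (rule Lmult)
  have Linv: "carrier (inv_group (?L A) (laurent ?S)) =
      {J \<in> carrier (inv_group (?L A) (laurent B)). ideal_prod (laurent B) J (?L C) = ?L C}"
    by (rule LB.inv_group_restrict(3)[OF LS _ LAC(1) LAS LAC(2,3)]) (rule Lmult)
  note base = B.inv_group_restrict(3)[of ?S C A, OF S.cring_axioms _ _ _ _ AC(1) AS AC(2,3), simplified]
  define h where "h = (\<lambda>J. ideal_prod (laurent B) J (?L C))"
  let ?G1 = "laurent_inv_group A ?S" and ?G2 = "laurent_inv_group A B" and ?G3 = "laurent_inv_group C B"
  have G1: "?G1 = inv_group (?L A) (laurent ?S)" by (simp add: laurent_inv_group_def)
  have G2: "?G2 = inv_group (?L A) (laurent B)" and G3: "?G3 = inv_group (?L C) (laurent B)"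
    by (simp_all add: laurent_inv_group_def)
  have hom: "h \<in> hom ?G2 ?G3"
    unfolding h_def G2 G3 by (rule LB.inv_ext_hom[OF LAC])
  \<comment> \<open>Exactness of the Laurent row at its first two places: the invertible
    A[X, X^-1]-submodules of C[X, X^-1] form the kernel of h.\<close>
  have carG1: "carrier ?G1 = {J \<in> carrier ?G2. h J = \<one>\<^bsub>?G3\<^esub>}"
    unfolding G1 Linv by (simp add: G2 G3 h_def inv_group_def)
  have G1C: "J \<subseteq> ?L C" if "J \<in> carrier ?G1" for J
    using S.cring_laurent cring.inv_groupD(2)[OF S.cring_laurent LAS] that LScar by (simp add: G1)
  have incl: "(\<lambda>J. J) \<in> hom ?G1 ?G2"
  proof (rule homI)
    fix I J assume "I \<in> carrier ?G1" "J \<in> carrier ?G1"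
    from Lprod[OF this[THEN G1C]]
    show "I \<otimes>\<^bsub>?G1\<^esub> J = I \<otimes>\<^bsub>?G2\<^esub> J" by (simp add: G1 G2 inv_group_def)
  qed (simp add: carG1)
  have ext: "h (?L I) = ?L (ideal_prod B I C)" if "I \<in> carrier (inv_group A B)" for I
    unfolding h_def
    by (rule B.ideal_prod_laurent_sub[OF B.inv_groupD(2,3)[OF AC(1) that] subringE(1,2)[OF AC(2)]])
  have cover: "\<exists>D\<in>towers B A C. c \<in> D" if "c \<in> C" for c
    by (rule B.subintegral_towers[OF assms(5) that])
  have surj: "h ` carrier ?G2 = carrier ?G3"
  proof
    show "h ` carrier ?G2 \<subseteq> carrier ?G3" using hom_in_carrier[OF hom] by blast
    show "carrier ?G3 \<subseteq> h ` carrier ?G2"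
    proof
      fix K assume "K \<in> carrier ?G3"
      then have "invertible_submodule (?L C) (laurent B) K" by (simp add: G3 inv_group_def)
      \<comment> \<open>Finite sets of Laurent polynomials over \<open>C\<close> lie in towers over
        A[X, X^-1], so the surjectivity result applies with B[X, X^-1] as ambient ring.\<close>
      from LB.inv_ext_surj[OF LAC B.towers_laurent_cover[OF AC cover] this]
      obtain I where "invertible_submodule (?L A) (laurent B) I" "h I = K"
        unfolding h_def by blast
      then show "K \<in> h ` carrier ?G2" by (auto simp: G2 inv_group_def)
    qed
  qed
  \<comment> \<open>Surjectivity for the rings \<open>A\<close>, \<open>C\<close>, \<open>B\<close>
    themselves enters here: every invertible \<open>C\<close>-module is extended from
    \<open>A\<close>, and extending scalars commutes with passing to Laurent polynomials.\<close>
  have img23: "h ` laurent_image A B = laurent_image C B"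
  proof -
    have "(\<lambda>I. ideal_prod B I C) ` carrier (inv_group A B) = carrier (inv_group C B)"
    proof
      show "(\<lambda>I. ideal_prod B I C) ` carrier (inv_group A B) \<subseteq> carrier (inv_group C B)"
        using hom_in_carrier[OF B.inv_ext_hom[OF AC]] by blast
      show "carrier (inv_group C B) \<subseteq> (\<lambda>I. ideal_prod B I C) ` carrier (inv_group A B)"
      proof
        fix K assume "K \<in> carrier (inv_group C B)"
        then have "invertible_submodule C B K" by (simp add: inv_group_def)
        from B.inv_ext_surj[OF AC B.towers_finite[OF AC cover] this]
        obtain I where "invertible_submodule A B I" "ideal_prod B I C = K" by blast
        then show "K \<in> (\<lambda>I. ideal_prod B I C) ` carrier (inv_group A B)"
          by (auto simp: inv_group_def)
      qed
    qed
    moreover have "h ` laurent_image A B = ?L ` (\<lambda>I. ideal_prod B I C) ` carrier (inv_group A B)"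
      unfolding B.laurent_image_eq[OF AC(1)] image_image by (rule image_cong[OF refl ext])
    ultimately show ?thesis unfolding B.laurent_image_eq[OF AC(2)] by simp
  qed
  \<comment> \<open>An extended module lies in the kernel of h exactly if I C and C have the same
    Laurent extension; by cancellation this means I C = C, so the module already comes from I(A,
    C).\<close>
  have img12: "laurent_image A ?S = laurent_image A B \<inter> carrier ?G1"
  proof -
    have "?L I \<in> carrier ?G1 \<longleftrightarrow> ideal_prod B I C = C" if I: "I \<in> carrier (inv_group A B)" for I
    proof -
      have LI: "?L I \<in> carrier ?G2"
        using B.invertible_submodule_laurent_sub[OF AC(1)] I by (simp add: G2 inv_group_def)
      have z: "\<zero>\<^bsub>B\<^esub> \<in> ideal_prod B I C"
        by (rule B.ideal_prod_zero[OF B.inv_groupD(2,3)[OF AC(1) I] subringE(2)[OF AC(2)]])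
      have "?L I \<in> carrier ?G1 \<longleftrightarrow> ?L (ideal_prod B I C) = ?L C"
        unfolding carG1 using LI ext[OF I] by (simp add: G3 inv_group_def)
      also have "\<dots> \<longleftrightarrow> ideal_prod B I C = C"
        using B.laurent_sub_cancel[OF z subringE(2)[OF AC(2)]] by auto
      finally show ?thesis .
    qed
    then have "?L ` {I \<in> carrier (inv_group A B). ideal_prod B I C = C}
        = ?L ` carrier (inv_group A B) \<inter> carrier ?G1" by auto
    moreover have "laurent_sub ?S = ?L" by (simp add: fun_eq_iff laurent_def)
    ultimately show ?thesis
      unfolding S.laurent_image_eq[OF AS] B.laurent_image_eq[OF AC(1)] base by simp
  qed
  have "MI_ext C B = induced_map ?G3 (laurent_image C B) h"
    unfolding MI_ext_def h_def ..
  moreover have "MI_incl A B = induced_map ?G2 (laurent_image A B) (\<lambda>J. J)"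
    unfolding MI_incl_def ..
  ultimately show ?thesis
    unfolding MI_def
    using exact_seq_Mod[OF S.comm_group_laurent_inv_group[OF AS] B.comm_group_laurent_inv_group[OF AC(1)]
        B.comm_group_laurent_inv_group[OF AC(2)] S.subgroup_laurent_image[OF AS]
        B.subgroup_laurent_image[OF AC(1)] B.subgroup_laurent_image[OF AC(2)]
        incl hom carG1 surj img12 img23]
    by simp
qed

end
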